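(* Let $(B,g_B,J_B)$ and $(F,g_F,J_F)$ be almost product singular semi-Riemannian manifolds, $b:B\times F\to\mathbb R$ smooth, and $\widetilde{\mathcal K}$ the almost product Koszul form of the (possibly degenerate) twisted product $B\times_bF$ with $J=(J_B,J_F)$. For all $X,Y,Z\in\Gamma(TB)$ and $U,V,W\in\Gamma(TF)$: (1) $\widetilde{\mathcal K}(X,Y,Z)=\widetilde{\mathcal K}_B(X,Y,Z)$; (2) $\widetilde{\mathcal K}(X,Y,W)=\widetilde{\mathcal K}(X,W,Y)=\widetilde{\mathcal K}(W,X,Y)=0$; (3) $\widetilde{\mathcal K}(X,V,W)=bX(b)g_F(V,W)$; (4) $\widetilde{\mathcal K}(V,X,W)=-\widetilde{\mathcal K}(V,W,X)=\frac12\big(bX(b)g_F(V,W)+bJ_BX(b)g_F(V,J_FW)\big)$; (5) $\widetilde{\mathcal K}(U,V,W)=bU(b)g_F(V,W)+\frac12bV(b)g_F(U,W)-\frac12bW(b)g_F(U,V)+\frac12bJ_FV(b)g_F(U,J_FW)-\frac12bJ_FW(b)g_F(U,J_FV)+b^2\widetilde{\mathcal K}_F(U,V,W)$.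
   Context: A singular semi-Riemannian manifold $(M,g)$ is a smooth manifold with a smooth symmetric bilinear form $g$ on $TM$, possibly degenerate and of variable signature. Its Koszul form is $\mathcal K(X,Y,Z)=\frac12\{X(g(Y,Z))+Y(g(Z,X))-Z(g(X,Y))-g(X,[Y,Z])+g(Y,[Z,X])+g(Z,[X,Y])\}$. It is almost product if equipped with a bundle endomorphism $J:TM\to TM$ with $J^2=\mathrm{id}$ and $g(JX,JY)=g(X,Y)$; the almost product Koszul form is $\widetilde{\mathcal K}(X,Y,Z)=\frac12[\mathcal K(X,Y,Z)+\mathcal K(X,JY,JZ)]$. The twisted product $B\times_bF$ with twisting function $b:B\times F\to\mathbb R$ (smooth, possibly vanishing) is $B\times F$ with $g=\pi_B^*(g_B)+b^2\pi_F^*(g_F)$, $\pi_B,\pi_F$ the canonical projections; $J$ acts as $J_B$ on $TB$ and $J_F$ on $TF$. Vector fields in $\Gamma(TB)$, $\Gamma(TF)$ are identified with their lifts to the product, and functions and tensors on the factors with their pullbacks. Subscripts $B$, $F$ denote (lifts of) objects of that factor. $J_BX(b)=(J_BX)(b)$, $J_FV(b)=(J_FV)(b)$. *)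

theory Defs
  imports "HOL-Analysis.Analysis"
begin

section \<open>Smooth maps between normed spaces\<close>

text \<open>On an open subset of a finite-dimensional space, \<open>f\<close> is \<open>C\<^sup>k\<^sup>+\<^sup>1\<close> iff it is differentiable and
  all its directional derivatives are \<open>C\<^sup>k\<close>.\<close>

primrec Ck_on :: "nat \<Rightarrow> 'e::real_normed_vector set \<Rightarrow> ('e \<Rightarrow> 'f::real_normed_vector) \<Rightarrow> bool" where
  "Ck_on 0 S f \<longleftrightarrow> continuous_on S f"
| "Ck_on (Suc k) S f \<longleftrightarrow>
     (\<forall>x\<in>S. f differentiable (at x)) \<and> (\<forall>v. Ck_on k S (\<lambda>x. frechet_derivative f (at x) v))"

definition smooth_on :: "'e::real_normed_vector set \<Rightarrow> ('e \<Rightarrow> 'f::real_normed_vector) \<Rightarrow> bool" where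
  "smooth_on S f \<longleftrightarrow> (\<forall>k. Ck_on k S f)"

section \<open>Smooth manifolds\<close>

text \<open>The points of a manifold are the elements of a Hausdorff, second countable type \<open>'m\<close>; its smooth
  structure is given by an atlas, not required to be maximal. A chart is a pair of its domain and its
  coordinate map, the values of the latter outside the domain being irrelevant. The model space is an
  arbitrary finite-dimensional normed space rather than a \<open>euclidean_space\<close>, because the latter class
  excludes dimension 0.\<close>

type_synonym ('m, 'e) atlas = "('m set \<times> ('m \<Rightarrow> 'e)) set"

locale smooth_manifold =
  fixes \<A> :: "('m::{second_countable_topology, t2_space}, 'e::real_normed_vector) atlas"
  assumes finite_dimensional: "\<exists>S. finite S \<and> span S = (UNIV :: 'e set)"
    and covers: "(\<Union>(D, \<phi>)\<in>\<A>. D) = UNIV"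
    and chart: "(D, \<phi>) \<in> \<A> \<Longrightarrow>
      open D \<and> open (\<phi> ` D) \<and> homeomorphism D (\<phi> ` D) \<phi> (inv_into D \<phi>)"
    and compatible: "(D, \<phi>) \<in> \<A> \<Longrightarrow> (D', \<phi>') \<in> \<A> \<Longrightarrow>
      smooth_on (\<phi> ` (D \<inter> D')) (\<phi>' \<circ> inv_into D \<phi>)"

definition smooth_fun :: "('m, 'e::real_normed_vector) atlas \<Rightarrow> ('m \<Rightarrow> real) \<Rightarrow> bool" where
  "smooth_fun \<A> f \<longleftrightarrow> (\<forall>(D, \<phi>)\<in>\<A>. smooth_on (\<phi> ` D) (f \<circ> inv_into D \<phi>))"

definition prod_atlas :: "('m, 'e) atlas \<Rightarrow> ('n, 'f) atlas \<Rightarrow> ('m \<times> 'n, 'e \<times> 'f) atlas" where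
  "prod_atlas \<A> \<B> = {(D \<times> E, map_prod \<phi> \<psi>) | D \<phi> E \<psi>. (D, \<phi>) \<in> \<A> \<and> (E, \<psi>) \<in> \<B>}"

section \<open>Tangent vectors and vector fields\<close>

text \<open>Tangent vectors at \<open>p\<close> are the derivations of \<open>C\<^sup>\<infinity>\<close> at \<open>p\<close>. Since functionals in HOL are also
  defined on non-smooth functions, they are normalised to vanish there; this makes tangent vectors
  equal iff they agree on smooth functions.\<close>

type_synonym 'm tvec = "('m \<Rightarrow> real) \<Rightarrow> real"

definition tvec_add :: "'m tvec \<Rightarrow> 'm tvec \<Rightarrow> 'm tvec" where
  "tvec_add v w = (\<lambda>f. v f + w f)"

definition tvec_scale :: "real \<Rightarrow> 'm tvec \<Rightarrow> 'm tvec" where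
  "tvec_scale c v = (\<lambda>f. c * v f)"

definition tangent_space :: "('m, 'e::real_normed_vector) atlas \<Rightarrow> 'm \<Rightarrow> 'm tvec set" where
  "tangent_space \<A> p = {v.
     (\<forall>f h. smooth_fun \<A> f \<longrightarrow> smooth_fun \<A> h \<longrightarrow> v (\<lambda>x. f x + h x) = v f + v h) \<and>
     (\<forall>c f. smooth_fun \<A> f \<longrightarrow> v (\<lambda>x. c * f x) = c * v f) \<and>
     (\<forall>f h. smooth_fun \<A> f \<longrightarrow> smooth_fun \<A> h \<longrightarrow> v (\<lambda>x. f x * h x) = f p * v h + h p * v f) \<and>
     (\<forall>f. \<not> smooth_fun \<A> f \<longrightarrow> v f = 0)}"

text \<open>The differential of \<open>\<Phi>\<close>, where \<open>\<B>\<close> is the atlas of the codomain of \<open>\<Phi>\<close>. The base point is not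
  needed.\<close>

definition pushforward ::
    "('n, 'f::real_normed_vector) atlas \<Rightarrow> ('m \<Rightarrow> 'n) \<Rightarrow> 'm tvec \<Rightarrow> 'n tvec" where
  "pushforward \<B> \<Phi> v = (\<lambda>f. if smooth_fun \<B> f then v (f \<circ> \<Phi>) else 0)"

type_synonym 'm vfield = "'m \<Rightarrow> 'm tvec"

definition deriv_along :: "'m vfield \<Rightarrow> ('m \<Rightarrow> real) \<Rightarrow> 'm \<Rightarrow> real" where
  "deriv_along X f = (\<lambda>p. X p f)"

definition vector_field :: "('m, 'e::real_normed_vector) atlas \<Rightarrow> 'm vfield \<Rightarrow> bool" where
  "vector_field \<A> X \<longleftrightarrow>
     (\<forall>p. X p \<in> tangent_space \<A> p) \<and> (\<forall>f. smooth_fun \<A> f \<longrightarrow> smooth_fun \<A> (deriv_along X f))"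

definition lie_bracket :: "'m vfield \<Rightarrow> 'm vfield \<Rightarrow> 'm vfield" where
  "lie_bracket X Y = (\<lambda>p f. X p (deriv_along Y f) - Y p (deriv_along X f))"

section \<open>Almost product singular semi-Riemannian manifolds\<close>

type_synonym 'm tensor2 = "'m \<Rightarrow> 'm tvec \<Rightarrow> 'm tvec \<Rightarrow> real"

type_synonym 'm endo = "'m \<Rightarrow> 'm tvec \<Rightarrow> 'm tvec"

definition eval_tensor :: "'m tensor2 \<Rightarrow> 'm vfield \<Rightarrow> 'm vfield \<Rightarrow> 'm \<Rightarrow> real" where
  "eval_tensor g X Y = (\<lambda>p. g p (X p) (Y p))"

definition eval_endo :: "'m endo \<Rightarrow> 'm vfield \<Rightarrow> 'm vfield" where
  "eval_endo J X = (\<lambda>p. J p (X p))"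

text \<open>No condition is imposed on the rank or the signature of \<open>g\<close>. Linearity in the second argument
  follows by symmetry.\<close>

locale singular_semi_riemannian = smooth_manifold \<A>
  for \<A> :: "('m::{second_countable_topology, t2_space}, 'e::real_normed_vector) atlas" +
  fixes g :: "'m tensor2"
  assumes metric_sym: "v \<in> tangent_space \<A> p \<Longrightarrow> w \<in> tangent_space \<A> p \<Longrightarrow> g p v w = g p w v"
    and metric_add: "u \<in> tangent_space \<A> p \<Longrightarrow> v \<in> tangent_space \<A> p \<Longrightarrow> w \<in> tangent_space \<A> p \<Longrightarrow>
      g p (tvec_add u v) w = g p u w + g p v w"
    and metric_scale: "v \<in> tangent_space \<A> p \<Longrightarrow> w \<in> tangent_space \<A> p \<Longrightarrow>
      g p (tvec_scale c v) w = c * g p v w"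
    and metric_smooth: "vector_field \<A> X \<Longrightarrow> vector_field \<A> Y \<Longrightarrow> smooth_fun \<A> (eval_tensor g X Y)"

locale almost_product = singular_semi_riemannian \<A> g
  for \<A> :: "('m::{second_countable_topology, t2_space}, 'e::real_normed_vector) atlas"
    and g :: "'m tensor2" +
  fixes J :: "'m endo"
  assumes J_closed: "v \<in> tangent_space \<A> p \<Longrightarrow> J p v \<in> tangent_space \<A> p"
    and J_add: "v \<in> tangent_space \<A> p \<Longrightarrow> w \<in> tangent_space \<A> p \<Longrightarrow>
      J p (tvec_add v w) = tvec_add (J p v) (J p w)"
    and J_scale: "v \<in> tangent_space \<A> p \<Longrightarrow> J p (tvec_scale c v) = tvec_scale c (J p v)"
    and J_smooth: "vector_field \<A> X \<Longrightarrow> vector_field \<A> (eval_endo J X)"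
    and J_involution: "v \<in> tangent_space \<A> p \<Longrightarrow> J p (J p v) = v"
    and J_isometry: "v \<in> tangent_space \<A> p \<Longrightarrow> w \<in> tangent_space \<A> p \<Longrightarrow>
      g p (J p v) (J p w) = g p v w"

definition koszul :: "'m tensor2 \<Rightarrow> 'm vfield \<Rightarrow> 'm vfield \<Rightarrow> 'm vfield \<Rightarrow> 'm \<Rightarrow> real" where
  "koszul g X Y Z = (\<lambda>p. 1/2 *
     (deriv_along X (eval_tensor g Y Z) p
      + deriv_along Y (eval_tensor g Z X) p
      - deriv_along Z (eval_tensor g X Y) p
      - eval_tensor g X (lie_bracket Y Z) p
      + eval_tensor g Y (lie_bracket Z X) p
      + eval_tensor g Z (lie_bracket X Y) p))"

definition ap_koszul ::
    "'m tensor2 \<Rightarrow> 'm endo \<Rightarrow> 'm vfield \<Rightarrow> 'm vfield \<Rightarrow> 'm vfield \<Rightarrow> 'm \<Rightarrow> real" where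
  "ap_koszul g J X Y Z =
     (\<lambda>p. 1/2 * (koszul g X Y Z p + koszul g X (eval_endo J Y) (eval_endo J Z) p))"

section \<open>Twisted products\<close>

definition twisted_metric ::
    "('m, 'e::real_normed_vector) atlas \<Rightarrow> ('n, 'f::real_normed_vector) atlas \<Rightarrow>
     'm tensor2 \<Rightarrow> 'n tensor2 \<Rightarrow> ('m \<times> 'n \<Rightarrow> real) \<Rightarrow> ('m \<times> 'n) tensor2" where
  "twisted_metric \<A> \<B> g h b = (\<lambda>(p, q) v w.
     g p (pushforward \<A> fst v) (pushforward \<A> fst w)
     + (b (p, q))\<^sup>2 * h q (pushforward \<B> snd v) (pushforward \<B> snd w))"

text \<open>The inclusions of the tangent spaces of the factors at \<open>p\<close>, \<open>q\<close> into the tangent space at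
  \<open>(p, q)\<close> are the differentials of \<open>x \<mapsto> (x, q)\<close> and \<open>y \<mapsto> (p, y)\<close>.\<close>

definition lift_fst ::
    "('m, 'e::real_normed_vector) atlas \<Rightarrow> ('n, 'f::real_normed_vector) atlas \<Rightarrow>
     'm vfield \<Rightarrow> ('m \<times> 'n) vfield" where
  "lift_fst \<A> \<B> X = (\<lambda>(p, q). pushforward (prod_atlas \<A> \<B>) (\<lambda>x. (x, q)) (X p))"

definition lift_snd ::
    "('m, 'e::real_normed_vector) atlas \<Rightarrow> ('n, 'f::real_normed_vector) atlas \<Rightarrow>
     'n vfield \<Rightarrow> ('m \<times> 'n) vfield" where
  "lift_snd \<A> \<B> V = (\<lambda>(p, q). pushforward (prod_atlas \<A> \<B>) (\<lambda>y. (p, y)) (V q))"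

definition prod_endo ::
    "('m, 'e::real_normed_vector) atlas \<Rightarrow> ('n, 'f::real_normed_vector) atlas \<Rightarrow>
     'm endo \<Rightarrow> 'n endo \<Rightarrow> ('m \<times> 'n) endo" where
  "prod_endo \<A> \<B> J K = (\<lambda>(p, q) v. tvec_add
     (pushforward (prod_atlas \<A> \<B>) (\<lambda>x. (x, q)) (J p (pushforward \<A> fst v)))
     (pushforward (prod_atlas \<A> \<B>) (\<lambda>y. (p, y)) (K q (pushforward \<B> snd v))))"

end

theory Submission
  imports Defs
begin

text \<open>
  Both the Koszul form and the metric of a twisted product are determined on lifts by a few facts. The
  metric is \<open>g\<^sub>B\<close> on lifts from the base, \<open>b\<^sup>2 g\<^sub>F\<close> on lifts from the fiber, and the two kinds of lifts are
  orthogonal. Brackets of lifts from the same factor are lifts of brackets, and lifts from different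
  factors commute. So in the Koszul formula only the terms of the factors survive, together with
  those in which a derivative hits \<open>b\<^sup>2\<close> and gives \<open>2 b X(b)\<close>. The product structure maps lifts to lifts;
  averaging the Koszul form over \<open>(Y, Z)\<close> and \<open>(J Y, J Z)\<close> then yields all the formulas, the two halves
  being equal in the third one because \<open>J\<^sub>F\<close> is an isometry.

  The work lies in the brackets. Tangent vectors are derivations of smooth functions, and the bracket of
  two lifts applies a derivation to a derived function. That lifts from different factors commute
  (\<open>derivations_commute\<close>) and that derived functions are smooth on the product
  (\<open>smooth_fun_derivative_snd\<close>) is not a formal consequence of the product rule: it needs that a derivation
  is a directional derivative in a chart (\<open>tangent_vector_in_chart\<close>), with smooth components in the case
  of a vector field (\<open>vector_field_in_chart\<close>). Given this, the two statements become the symmetry of second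
  derivatives and the smoothness of partial derivatives.

  The representation in charts rests on Hadamard's lemma (\<open>smooth_hadamard\<close>) and on bump functions that
  extend functions from charts to the manifold (\<open>chart_cutoff\<close>). The model space is any finite-dimensional
  normed space; its coordinates are continuous (\<open>coefficient_bound\<close>), and expanding vectors in them
  (\<open>finite_coordinates\<close>) gives the compactness of balls, the chain rule for \<open>C\<^sup>k\<close> maps, and the total
  differentiability of integrals with a parameter.
\<close>

section \<open>Iterated directional derivatives\<close>

lemma Ck_on_subset:
  assumes "Ck_on k S f" "T \<subseteq> S" shows "Ck_on k T f"
  using assms
proof (induction k arbitrary: f)
  case 0 then show ?case by (auto intro: continuous_on_subset)
next
  case (Suc k)
  have "Ck_on k T (\<lambda>x. frechet_derivative f (at x) v)" for v
    using Suc.IH Suc.prems by auto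
  then show ?case using Suc.prems by auto
qed

text \<open>Derivatives at the points of an open set do not see values outside of it. Openness cannot be dropped:
  \<open>Ck_on\<close> refers to two-sided derivatives, not to derivatives within \<open>S\<close>.\<close>

lemma Ck_on_cong:
  assumes "open S" "Ck_on k S f" "\<And>x. x \<in> S \<Longrightarrow> f x = g x"
  shows "Ck_on k S g"
  using assms(2,3)
proof (induction k arbitrary: f g)
  case 0 then show ?case using continuous_on_cong by fastforce
next
  case (Suc k)
  have D: "(g has_derivative frechet_derivative f (at x)) (at x)" if "x \<in> S" for x
  proof -
    have "(f has_derivative frechet_derivative f (at x)) (at x)"
      using Suc.prems that frechet_derivative_works by auto
    then show ?thesis using has_derivative_transform_within_open[OF _ assms(1) that] Suc.prems(2) by blast
  qed
  have E: "frechet_derivative f (at x) v = frechet_derivative g (at x) v" if "x \<in> S" for x v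
    using frechet_derivative_at[OF D[OF that]] by simp
  show ?case
  proof (simp, intro conjI ballI allI)
    fix x assume "x \<in> S" then show "g differentiable at x" using D differentiable_def by blast
  next
    fix v show "Ck_on k S (\<lambda>x. frechet_derivative g (at x) v)"
      by (rule Suc.IH[of "\<lambda>x. frechet_derivative f (at x) v"]) (use Suc.prems E in auto)
  qed
qed

lemma Ck_on_local:
  assumes "\<And>x. x \<in> S \<Longrightarrow> \<exists>T. open T \<and> x \<in> T \<and> Ck_on k T f"
  shows "Ck_on k S f"
  using assms
proof (induction k arbitrary: f)
  case 0
  have "isCont f x" if x: "x \<in> S" for x
  proof -
    obtain T where "open T" "x \<in> T" "continuous_on T f" using 0[OF x] by auto
    then show ?thesis by (simp add: continuous_on_eq_continuous_at)
  qed
  then show ?case by (simp add: continuous_at_imp_continuous_on)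
next
  case (Suc k)
  show ?case
  proof (simp, intro conjI ballI allI)
    fix x assume "x \<in> S"
    then obtain T where "x \<in> T" "Ck_on (Suc k) T f" using Suc.prems by blast
    then show "f differentiable at x" by simp
  next
    fix v show "Ck_on k S (\<lambda>x. frechet_derivative f (at x) v)"
    proof (rule Suc.IH)
      fix x assume "x \<in> S"
      then obtain T where "open T" "x \<in> T" "Ck_on (Suc k) T f" using Suc.prems by blast
      then show "\<exists>T. open T \<and> x \<in> T \<and> Ck_on k T (\<lambda>x. frechet_derivative f (at x) v)"
        by (intro exI[of _ T]) simp
    qed
  qed
qed

text \<open>Exhibiting a derivative avoids computing with \<open>frechet_derivative\<close>; the inductions on \<open>k\<close> below use
  this rule for their steps.\<close>

lemma Ck_on_SucI:
  assumes "open S" "\<And>x. x \<in> S \<Longrightarrow> (f has_derivative D x) (at x)"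
    and "\<And>v. Ck_on k S (\<lambda>x. D x v)"
  shows "Ck_on (Suc k) S f"
proof (simp, intro conjI ballI allI)
  fix x assume "x \<in> S" then show "f differentiable at x"
    using assms(2) differentiable_def by blast
next
  fix v
  have "D x v = frechet_derivative f (at x) v" if "x \<in> S" for x
    using frechet_derivative_at[OF assms(2)[OF that]] by simp
  then show "Ck_on k S (\<lambda>x. frechet_derivative f (at x) v)"
    by (rule Ck_on_cong[OF assms(1) assms(3)[of v]])
qed

lemma Ck_on_has_derivative:
  assumes "Ck_on (Suc k) S f" "x \<in> S"
  shows "(f has_derivative frechet_derivative f (at x)) (at x)"
  using assms frechet_derivative_works by auto

lemma Ck_on_frechet_derivative:
  "Ck_on (Suc k) S f \<Longrightarrow> Ck_on k S (\<lambda>x. frechet_derivative f (at x) v)"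
  by simp

lemma Ck_on_SucD: "Ck_on (Suc k) S f \<Longrightarrow> Ck_on k S f"
proof (induction k arbitrary: f)
  case 0
  then have "isCont f x" if "x \<in> S" for x
    using that by (simp add: differentiable_imp_continuous_within)
  then show ?case by (simp add: continuous_at_imp_continuous_on)
next
  case (Suc k)
  have "Ck_on k S (\<lambda>x. frechet_derivative f (at x) v)" for v
    by (rule Suc.IH[OF Ck_on_frechet_derivative[OF Suc.prems]])
  moreover have "\<forall>x\<in>S. f differentiable (at x)" using Suc.prems by (subst (asm) Ck_on.simps) blast
  ultimately show ?case by (subst Ck_on.simps) blast
qed

text \<open>As a rewrite rule this equation would expand every \<open>C\<^sup>k\<^sup>+\<^sup>1\<close> hypothesis into statements about all
  directions.\<close>

declare Ck_on.simps(2) [simp del]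

lemma Ck_on_const: "open S \<Longrightarrow> Ck_on k S (\<lambda>x. c)"
proof (induction k arbitrary: c)
  case (Suc k)
  show ?case by (rule Ck_on_SucI[where D="\<lambda>x v. 0"]) (auto intro: Suc)
qed auto

lemma Ck_on_add:
  assumes "open S" "Ck_on k S f" "Ck_on k S g" shows "Ck_on k S (\<lambda>x. f x + g x)"
  using assms(2,3)
proof (induction k arbitrary: f g)
  case 0 then show ?case by (auto intro: continuous_intros)
next
  case (Suc k)
  show ?case
    by (rule Ck_on_SucI[OF assms(1),
        where D="\<lambda>x v. frechet_derivative f (at x) v + frechet_derivative g (at x) v"])
      (rule has_derivative_add Ck_on_has_derivative[OF Suc.prems(1)] Ck_on_has_derivative[OF Suc.prems(2)]
        Suc.IH Ck_on_frechet_derivative Suc.prems | assumption)+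
qed

lemma Ck_on_sum:
  assumes "open S" "\<And>i. i \<in> I \<Longrightarrow> Ck_on k S (f i)"
  shows "Ck_on k S (\<lambda>x. \<Sum>i\<in>I. f i x)"
  using assms(2)
  by (induction I rule: infinite_finite_induct) (auto intro!: Ck_on_const Ck_on_add assms(1))

lemma Ck_on_bounded_linear:
  assumes "bounded_linear L" "open S" "Ck_on k S f" shows "Ck_on k S (\<lambda>x. L (f x))"
  using assms(3)
proof (induction k arbitrary: f)
  case 0 then show ?case using assms(1) by (simp add: bounded_linear.continuous_on)
next
  case (Suc k)
  show ?case
    by (rule Ck_on_SucI[OF assms(2), where D="\<lambda>x v. L (frechet_derivative f (at x) v)"])
      (rule bounded_linear.has_derivative[OF assms(1)] Ck_on_has_derivative[OF Suc.prems]
        Suc.IH Ck_on_frechet_derivative Suc.prems | assumption)+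
qed

lemma (in bounded_bilinear) Ck_on_prod:
  assumes "open S" "Ck_on k S f" "Ck_on k S g" shows "Ck_on k S (\<lambda>x. prod (f x) (g x))"
  using assms(2,3)
proof (induction k arbitrary: f g)
  case 0 then show ?case by (auto intro: continuous_on)
next
  case (Suc k)
  show ?case
  proof (rule Ck_on_SucI[OF assms(1),
      where D="\<lambda>x v. prod (f x) (frechet_derivative g (at x) v) + prod (frechet_derivative f (at x) v) (g x)"])
    fix x assume "x \<in> S"
    then show "((\<lambda>x. prod (f x) (g x)) has_derivative
        (\<lambda>v. prod (f x) (frechet_derivative g (at x) v) + prod (frechet_derivative f (at x) v) (g x))) (at x)"
      by (intro FDERIV Ck_on_has_derivative[OF Suc.prems(1)] Ck_on_has_derivative[OF Suc.prems(2)])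
  next
    fix v
    have "Ck_on k S f" "Ck_on k S g" using Suc.prems Ck_on_SucD by blast+
    then show "Ck_on k S (\<lambda>x. prod (f x) (frechet_derivative g (at x) v) + prod (frechet_derivative f (at x) v) (g x))"
      by (intro Ck_on_add assms(1) Suc.IH Ck_on_frechet_derivative Suc.prems)
  qed
qed

lemmas Ck_on_mult = bounded_bilinear.Ck_on_prod[OF bounded_bilinear_mult]
lemmas Ck_on_scaleR = bounded_bilinear.Ck_on_prod[OF bounded_bilinear_scaleR]

text \<open>Precomposition with an affine map keeps the direction \<open>L v\<close> independent of the point, so the
  induction runs over the derivatives of \<open>f\<close> in fixed directions. This covers slices, projections and
  the exchange of factors in products.\<close>

lemma Ck_on_affine_compose:
  assumes "bounded_linear L" "open S" "open T" "(\<lambda>x. L x + c) ` S \<subseteq> T" "Ck_on k T f"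
  shows "Ck_on k S (\<lambda>x. f (L x + c))"
  using assms(5)
proof (induction k arbitrary: f)
  case 0
  have "continuous_on S (\<lambda>x. L x + c)"
    by (intro continuous_on_add continuous_on_const bounded_linear.continuous_on[OF assms(1)] continuous_on_id)
  then show ?case using continuous_on_compose2[OF _ _ assms(4)] 0 by simp
next
  case (Suc k)
  show ?case
  proof (rule Ck_on_SucI[OF assms(2), where D="\<lambda>x v. frechet_derivative f (at (L x + c)) (L v)"])
    fix x assume "x \<in> S"
    then have "L x + c \<in> T" using assms(4) by blast
    from Ck_on_has_derivative[OF Suc.prems this]
    have D: "(f has_derivative frechet_derivative f (at (L x + c))) (at (L x + c))" .
    have A: "((\<lambda>x. L x + c) has_derivative L) (at x)"
      using has_derivative_add[OF bounded_linear_imp_has_derivative[OF assms(1)] has_derivative_const[of c]] by simp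
    show "((\<lambda>x. f (L x + c)) has_derivative (\<lambda>v. frechet_derivative f (at (L x + c)) (L v))) (at x)"
      by (rule has_derivative_compose[OF A D])
  next
    fix v
    show "Ck_on k S (\<lambda>x. frechet_derivative f (at (L x + c)) (L v))"
      by (rule Suc.IH[of "\<lambda>y. frechet_derivative f (at y) (L v)", OF Ck_on_frechet_derivative[OF Suc.prems]])
  qed
qed

lemma Ck_on_id: "open S \<Longrightarrow> Ck_on k S (\<lambda>x. x)"
proof (induction k)
  case (Suc k)
  show ?case by (rule Ck_on_SucI[where D="\<lambda>x v. v"]) (auto intro: Suc Ck_on_const)
qed auto

lemma Ck_on_inverse: "Ck_on k {0<..} (inverse :: real \<Rightarrow> real)"
proof (induction k)
  case 0 then show ?case by (auto intro!: continuous_intros)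
next
  case (Suc k)
  show ?case
  proof (rule Ck_on_SucI[OF open_greaterThan, where D="\<lambda>x v. (inverse x * inverse x) * (- v)"])
    fix x :: real assume "x \<in> {0<..}"
    then show "(inverse has_derivative (\<lambda>v. inverse x * inverse x * - v)) (at x)"
      by (auto intro!: derivative_eq_intros simp: mult_ac)
  next
    fix v :: real
    show "Ck_on k {0<..} (\<lambda>x. inverse x * inverse x * - v)"
      by (intro Ck_on_mult Suc Ck_on_const open_greaterThan)
  qed
qed

section \<open>A smooth function that is flat at the origin\<close>

text \<open>The functions \<open>t\<^sup>-\<^sup>m exp (- 1/t)\<close>, extended by zero to \<open>t \<le> 0\<close>. Bump functions use \<open>m = 0\<close>; the
  whole family is closed under differentiation up to linear combinations, which turns its
  smoothness into an induction over the order of differentiability for all \<open>m\<close> at once.\<close>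

definition flat_exp :: "nat \<Rightarrow> real \<Rightarrow> real" where
  "flat_exp m t = (if 0 < t then inverse t ^ m * exp (- inverse t) else 0)"

lemma flat_exp_has_derivative:
  "(flat_exp m has_field_derivative flat_exp (m+2) t - of_nat m * flat_exp (Suc m) t) (at t)"
proof -
  consider "t > 0" | "t < 0" | "t = 0" by linarith
  then show ?thesis
  proof cases
    case 1
    have P: "n = 0 \<or> t ^ n = t * t ^ (n - Suc 0)" for n by (cases n) auto
    have "((\<lambda>t. inverse t ^ m * exp (- inverse t)) has_field_derivative
       flat_exp (m+2) t - of_nat m * flat_exp (Suc m) t) (at t)"
      using 1 P by (cases m) (auto intro!: derivative_eq_intros simp: flat_exp_def field_simps power2_eq_square)
    then show ?thesis
      by (rule DERIV_cong_ev[THEN iffD1, rotated 3])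
        (use 1 in \<open>auto simp: flat_exp_def intro!: eventually_mono[OF order_tendstoD(1)[OF tendsto_ident_at 1]]
          simp: eventually_nhds intro!: exI[of _ "{0<..}"]\<close>)
  next
    case 2
    have "((\<lambda>t::real. 0) has_field_derivative flat_exp (m+2) t - of_nat m * flat_exp (Suc m) t) (at t)"
      using 2 by (auto simp: flat_exp_def)
    then show ?thesis
      by (rule DERIV_cong_ev[THEN iffD1, rotated 3])
        (use 2 in \<open>auto simp: flat_exp_def eventually_nhds intro!: exI[of _ "{..<0}"]\<close>)
  next
    case 3
    have "((\<lambda>h. flat_exp m h / h) \<longlongrightarrow> 0) (at_right 0)"
    proof -
      \<comment> \<open>the difference quotient at \<open>0\<close>, in the variable \<open>1/h\<close>\<close>
      have "((\<lambda>x::real. x ^ Suc m / exp x) \<longlongrightarrow> 0) at_top" by (rule tendsto_power_div_exp_0)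
      then have "((\<lambda>h::real. inverse h ^ Suc m / exp (inverse h)) \<longlongrightarrow> 0) (at_right 0)"
        by (rule filterlim_compose[OF _ filterlim_inverse_at_top_right])
      then show ?thesis
        by (rule Lim_transform_eventually)
          (auto simp: eventually_at_filter flat_exp_def exp_minus field_simps)
    qed
    moreover have "((\<lambda>h. flat_exp m h / h) \<longlongrightarrow> 0) (at_left 0)"
      by (rule Lim_transform_eventually[OF tendsto_const])
        (auto simp: eventually_at_filter flat_exp_def)
    ultimately have "((\<lambda>h. flat_exp m h / h) \<longlongrightarrow> 0) (at 0)"
      by (simp add: filterlim_at_split)
    then show ?thesis using 3 by (simp add: DERIV_def flat_exp_def)
  qed
qed

lemma Ck_on_flat_exp: "Ck_on k UNIV (flat_exp m)"
proof (induction k arbitrary: m)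
  case 0
  have "isCont (flat_exp m) x" for x using flat_exp_has_derivative DERIV_isCont by blast
  then show ?case by (simp add: continuous_at_imp_continuous_on)
next
  case (Suc k)
  show ?case
  proof (rule Ck_on_SucI[OF open_UNIV, where D="\<lambda>t v. (flat_exp (m+2) t + (- of_nat m) * flat_exp (Suc m) t) * v"])
    fix t :: real
    show "(flat_exp m has_derivative (\<lambda>v. (flat_exp (m+2) t + - of_nat m * flat_exp (Suc m) t) * v)) (at t)"
      using flat_exp_has_derivative[of m t] by (simp add: has_field_derivative_def)
  qed (intro open_UNIV Ck_on_mult Ck_on_add Ck_on_const Suc)+
qed

section \<open>Symmetry of second derivatives\<close>

lemma has_derivative_line:
  fixes f :: "'a::real_normed_vector \<Rightarrow> real"
  assumes "(f has_derivative D) (at (y + s *\<^sub>R v))"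
  shows "((\<lambda>s. f (y + s *\<^sub>R v)) has_real_derivative D v) (at s within T)"
proof -
  have "((\<lambda>s. y + s *\<^sub>R v) has_derivative (\<lambda>s. s *\<^sub>R v)) (at s within T)"
    by (auto intro!: derivative_eq_intros)
  from has_derivative_compose[OF this assms]
  have "((\<lambda>s. f (y + s *\<^sub>R v)) has_derivative (\<lambda>s. D (s *\<^sub>R v))) (at s within T)" .
  moreover have "D (s *\<^sub>R v) = D v * s" for s
    using linear_scale[OF has_derivative_linear[OF assms]] by (simp add: mult.commute)
  ultimately show ?thesis by (simp add: has_field_derivative_def)
qed

text \<open>The second difference over the parallelogram spanned by \<open>h a\<close> and \<open>h b\<close> is a difference of \<open>F\<close>-increments
  in direction \<open>a\<close>; the mean value theorem in \<open>s\<close> and then in \<open>t\<close> makes it a second derivative. The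
  left-hand side is symmetric in \<open>a\<close> and \<open>b\<close>, so the two orders of differentiation can be compared.\<close>

lemma second_difference_mean_value:
  fixes F :: "'a::real_normed_vector \<Rightarrow> real"
  assumes "Ck_on 2 S F" "0 < h"
    and box: "\<And>s t. 0 \<le> s \<Longrightarrow> s \<le> h \<Longrightarrow> 0 \<le> t \<Longrightarrow> t \<le> h \<Longrightarrow> u + s *\<^sub>R a + t *\<^sub>R b \<in> S"
  shows "\<exists>s t. 0 < s \<and> s < h \<and> 0 < t \<and> t < h \<and>
    F (u + h *\<^sub>R a + h *\<^sub>R b) - F (u + h *\<^sub>R a) - F (u + h *\<^sub>R b) + F u =
    h * h * frechet_derivative (\<lambda>x. frechet_derivative F (at x) a) (at (u + s *\<^sub>R a + t *\<^sub>R b)) b"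
proof -
  let ?Fa = "\<lambda>x. frechet_derivative F (at x) a"
  have F: "(F has_derivative frechet_derivative F (at x)) (at x)" if "x \<in> S" for x
    using assms(1) that by (auto simp: numeral_2_eq_2 Ck_on.simps(2) frechet_derivative_works)
  have Fa: "(?Fa has_derivative frechet_derivative ?Fa (at x)) (at x)" if "x \<in> S" for x
    using assms(1) that by (auto simp: numeral_2_eq_2 Ck_on.simps(2) frechet_derivative_works)
  \<comment> \<open>the increment of \<open>F\<close> across the parallelogram in direction \<open>b\<close>\<close>
  define G where "G s = F ((u + h *\<^sub>R b) + s *\<^sub>R a) - F (u + s *\<^sub>R a)" for s
  have "(G has_real_derivative ?Fa (u + h *\<^sub>R b + s *\<^sub>R a) - ?Fa (u + s *\<^sub>R a)) (at s)"
    if "0 \<le> s" "s \<le> h" for s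
    unfolding G_def using box[of s h] box[of s 0] that assms(2)
    by (intro DERIV_diff has_derivative_line F) (auto simp: algebra_simps)
  from MVT2[OF assms(2), of G, OF this] obtain s where s: "0 < s" "s < h"
    "G h - G 0 = h * (?Fa (u + h *\<^sub>R b + s *\<^sub>R a) - ?Fa (u + s *\<^sub>R a))" by auto
  have "((\<lambda>t. ?Fa ((u + s *\<^sub>R a) + t *\<^sub>R b)) has_real_derivative
      frechet_derivative ?Fa (at (u + s *\<^sub>R a + t *\<^sub>R b)) b) (at t)"
    if "0 \<le> t" "t \<le> h" for t
    using box[of s t] that s by (intro has_derivative_line Fa) auto
  from MVT2[OF assms(2) this] obtain t where t: "0 < t" "t < h"
    "?Fa (u + s *\<^sub>R a + h *\<^sub>R b) - ?Fa (u + s *\<^sub>R a) =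
      h * frechet_derivative ?Fa (at (u + s *\<^sub>R a + t *\<^sub>R b)) b" by auto
  have "u + h *\<^sub>R b + s *\<^sub>R a = u + s *\<^sub>R a + h *\<^sub>R b" by simp
  then have "G h - G 0 = h * h * frechet_derivative ?Fa (at (u + s *\<^sub>R a + t *\<^sub>R b)) b"
    by (simp only: s(3) t(3) mult.assoc)
  moreover have "G h - G 0 = F (u + h *\<^sub>R a + h *\<^sub>R b) - F (u + h *\<^sub>R a) - F (u + h *\<^sub>R b) + F u"
    by (simp add: G_def algebra_simps)
  ultimately show ?thesis using s t by metis
qed

text \<open>Both mixed derivatives are limits of the same second difference divided by \<open>h\<^sup>2\<close>. If they differed at
  \<open>u\<close>, then on a parallelogram so small that each of them stays within half of the gap, they could
  not take a common value.\<close>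

lemma symmetric_second_derivative:
  fixes F :: "'a::real_normed_vector \<Rightarrow> real"
  assumes "open S" "u \<in> S" "Ck_on 2 S F"
  shows "frechet_derivative (\<lambda>x. frechet_derivative F (at x) a) (at u) b =
    frechet_derivative (\<lambda>x. frechet_derivative F (at x) b) (at u) a"
proof (rule ccontr)
  define D where "D a b x = frechet_derivative (\<lambda>x. frechet_derivative F (at x) a) (at x) b" for a b x
  assume "\<not> ?thesis"
  then have ne: "\<bar>D a b u - D b a u\<bar> > 0" (is "?e > 0") by (simp add: D_def)
  have "continuous_on S (D a b)" for a b
    using assms(3) by (simp add: numeral_2_eq_2 Ck_on.simps(2) D_def[abs_def])
  then have "isCont (D a b) u" for a b by (metis assms(1,2) continuous_on_eq_continuous_at)
  then have "(D a b \<longlongrightarrow> D a b u) (nhds u)" for a b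
    by (simp add: isCont_def tendsto_at_iff_tendsto_nhds)
  then have "\<forall>\<^sub>F x in nhds u. dist (D a b x) (D a b u) < ?e/2" for a b
    by (rule tendstoD) (use ne in simp)
  then have "\<forall>\<^sub>F x in nhds u. \<bar>D a b x - D a b u\<bar> < ?e/2" for a b
    by (simp only: dist_real_def)
  then have "\<forall>\<^sub>F x in nhds u. x \<in> S \<and> \<bar>D a b x - D a b u\<bar> < ?e/2 \<and> \<bar>D b a x - D b a u\<bar> < ?e/2"
    by (intro eventually_conj eventually_nhds_in_open assms(1,2))
  then obtain r where r: "r > 0" "\<And>x. dist x u < r \<Longrightarrow>
    x \<in> S \<and> \<bar>D a b x - D a b u\<bar> < ?e/2 \<and> \<bar>D b a x - D b a u\<bar> < ?e/2"
    unfolding eventually_nhds_metric by blast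
  define M where "M = norm a + norm b + 1"
  \<comment> \<open>chosen so that the parallelogram with sides \<open>h a\<close> and \<open>h b\<close> at \<open>u\<close> stays in the ball of radius \<open>r\<close>\<close>
  define h where "h = r / (2 * M)"
  have pos: "M > 0" by (simp add: M_def add_nonneg_pos)
  then have h: "h > 0" using r(1) by (simp add: h_def)
  have N: "dist (u + s *\<^sub>R a + t *\<^sub>R b) u < r" if "0 \<le> s" "s \<le> h" "0 \<le> t" "t \<le> h" for s t
  proof -
    have "norm (s *\<^sub>R a + t *\<^sub>R b) \<le> s * norm a + t * norm b"
      using norm_triangle_ineq[of "s *\<^sub>R a" "t *\<^sub>R b"] that by simp
    also have "\<dots> \<le> h * norm a + h * norm b" using that by (intro add_mono mult_right_mono) auto
    also have "\<dots> \<le> h * M" using h by (simp add: M_def algebra_simps)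
    also have "\<dots> = r / 2"
      using pos by (simp add: h_def)
    also have "\<dots> < r" using r(1) by simp
    finally show ?thesis by (simp add: dist_norm add.assoc)
  qed
  obtain s t where st: "0 < s" "s < h" "0 < t" "t < h"
    "F (u + h *\<^sub>R a + h *\<^sub>R b) - F (u + h *\<^sub>R a) - F (u + h *\<^sub>R b) + F u = h * h * D a b (u + s *\<^sub>R a + t *\<^sub>R b)"
    using second_difference_mean_value[OF assms(3) h, of u a b] r(2)[OF N] unfolding D_def by blast
  have N': "dist (u + s *\<^sub>R b + t *\<^sub>R a) u < r" if "0 \<le> s" "s \<le> h" "0 \<le> t" "t \<le> h" for s t
    using N[of t s] that by (simp add: algebra_simps)
  obtain s' t' where st': "0 < s'" "s' < h" "0 < t'" "t' < h"
    "F (u + h *\<^sub>R b + h *\<^sub>R a) - F (u + h *\<^sub>R b) - F (u + h *\<^sub>R a) + F u = h * h * D b a (u + s' *\<^sub>R b + t' *\<^sub>R a)"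
    using second_difference_mean_value[OF assms(3) h, of u b a] r(2)[OF N'] unfolding D_def by blast
  have "h * h * D a b (u + s *\<^sub>R a + t *\<^sub>R b) = h * h * D b a (u + s' *\<^sub>R b + t' *\<^sub>R a)"
    using st(5) st'(5) by (simp add: algebra_simps)
  then have "D a b (u + s *\<^sub>R a + t *\<^sub>R b) = D b a (u + s' *\<^sub>R b + t' *\<^sub>R a)" using h by simp
  moreover have "\<bar>D a b (u + s *\<^sub>R a + t *\<^sub>R b) - D a b u\<bar> < ?e/2"
    using r(2)[OF N] st(1-4) by simp
  moreover have "\<bar>D b a (u + s' *\<^sub>R b + t' *\<^sub>R a) - D b a u\<bar> < ?e/2"
    using r(2)[OF N'] st'(1-4) by simp
  ultimately show False using ne by (smt (verit) field_sum_of_halves)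
qed

section \<open>Smooth functions\<close>

lemma smooth_on_subset: "smooth_on S f \<Longrightarrow> T \<subseteq> S \<Longrightarrow> smooth_on T f"
  unfolding smooth_on_def by (blast intro: Ck_on_subset)

lemma smooth_on_cong: "open S \<Longrightarrow> smooth_on S f \<Longrightarrow> (\<And>x. x \<in> S \<Longrightarrow> f x = g x) \<Longrightarrow> smooth_on S g"
  unfolding smooth_on_def by (blast intro: Ck_on_cong)

lemma smooth_on_local:
  assumes "\<And>x. x \<in> S \<Longrightarrow> \<exists>T. open T \<and> x \<in> T \<and> smooth_on T f" shows "smooth_on S f"
  using assms unfolding smooth_on_def by (intro allI Ck_on_local) blast

lemma smooth_on_const: "open S \<Longrightarrow> smooth_on S (\<lambda>x. c)"
  by (simp add: smooth_on_def Ck_on_const)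

lemma smooth_on_add: "open S \<Longrightarrow> smooth_on S f \<Longrightarrow> smooth_on S g \<Longrightarrow> smooth_on S (\<lambda>x. f x + g x)"
  by (simp add: smooth_on_def Ck_on_add)

lemma smooth_on_mult:
  fixes f g :: "'a::real_normed_vector \<Rightarrow> real"
  shows "open S \<Longrightarrow> smooth_on S f \<Longrightarrow> smooth_on S g \<Longrightarrow> smooth_on S (\<lambda>x. f x * g x)"
  by (simp add: smooth_on_def Ck_on_mult)

lemma smooth_on_sum:
  "open S \<Longrightarrow> (\<And>i. i \<in> I \<Longrightarrow> smooth_on S (f i)) \<Longrightarrow> smooth_on S (\<lambda>x. \<Sum>i\<in>I. f i x)"
  by (simp add: smooth_on_def Ck_on_sum)

lemma smooth_on_bounded_linear: "bounded_linear L \<Longrightarrow> open S \<Longrightarrow> smooth_on S L"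
  using Ck_on_bounded_linear[of L S _ "\<lambda>x. x"] by (simp add: smooth_on_def Ck_on_id)

lemma smooth_on_affine_compose:
  "bounded_linear L \<Longrightarrow> open S \<Longrightarrow> open T \<Longrightarrow> (\<lambda>x. L x + c) ` S \<subseteq> T \<Longrightarrow> smooth_on T f
    \<Longrightarrow> smooth_on S (\<lambda>x. f (L x + c))"
  unfolding smooth_on_def by (intro allI Ck_on_affine_compose) auto

lemma smooth_on_frechet_derivative:
  "smooth_on S f \<Longrightarrow> smooth_on S (\<lambda>x. frechet_derivative f (at x) v)"
  unfolding smooth_on_def by (intro allI Ck_on_frechet_derivative) blast

lemma smooth_on_has_derivative:
  "smooth_on S f \<Longrightarrow> x \<in> S \<Longrightarrow> (f has_derivative frechet_derivative f (at x)) (at x)"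
  unfolding smooth_on_def by (intro Ck_on_has_derivative[of 0]) auto

lemma smooth_on_continuous: "smooth_on S f \<Longrightarrow> continuous_on S f"
  unfolding smooth_on_def by (metis Ck_on.simps(1))

section \<open>Finite-dimensional normed spaces\<close>

text \<open>Compactness in a finite-dimensional space of unknown dimension, built up one basis vector at a time
  as an image of a product of compact sets.\<close>

lemma compact_coefficient_box:
  fixes A :: "'a::real_normed_vector set"
  assumes "finite A"
  shows "compact ((\<lambda>a. \<Sum>b\<in>A. a b *\<^sub>R b) ` {a. \<forall>b\<in>A. \<bar>a b\<bar> \<le> (C::real)})" (is "compact (?box A)")
  using assms
proof (induction A rule: finite_induct)
  case empty
  have "?box {} = {0}" by auto
  then show ?case by simp
next
  case (insert x A)
  have "?box (insert x A) = (\<lambda>p. fst p *\<^sub>R x + snd p) ` (cball 0 C \<times> ?box A)" (is "?L = ?R")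
  proof (intro equalityI subsetI)
    fix y assume "y \<in> ?L"
    then obtain a where a: "\<forall>b\<in>insert x A. \<bar>a b\<bar> \<le> C" "y = (\<Sum>b\<in>insert x A. a b *\<^sub>R b)" by auto
    then show "y \<in> ?R" using insert.hyps
      by (intro image_eqI[where x="(a x, \<Sum>b\<in>A. a b *\<^sub>R b)"]) auto
  next
    fix y assume "y \<in> ?R"
    then obtain c a where a: "\<bar>c\<bar> \<le> C" "\<forall>b\<in>A. \<bar>a b\<bar> \<le> C" "y = c *\<^sub>R x + (\<Sum>b\<in>A. a b *\<^sub>R b)"
      by auto
    have "(\<Sum>b\<in>A. (a(x := c)) b *\<^sub>R b) = (\<Sum>b\<in>A. a b *\<^sub>R b)"
      using insert.hyps by (intro sum.cong) auto
    then show "y \<in> ?L" using insert.hyps a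
      by (intro image_eqI[where x="a(x := c)"]) auto
  qed
  moreover have "compact ?R"
    by (intro compact_continuous_image compact_Times insert.IH compact_cball continuous_intros)
  ultimately show ?case by simp
qed

text \<open>Coordinates are continuous. The combinations whose largest coefficient is \<open>\<plusminus>1\<close> form a finite union of
  translated boxes, hence a compact set, and by independence it misses \<open>0\<close>; so it has a positive
  distance \<open>\<delta>\<close> from \<open>0\<close>. Scaling yields the bound \<open>1/\<delta>\<close>.\<close>

lemma coefficient_bound:
  fixes B :: "'a::real_normed_vector set"
  assumes "finite B" "independent B"
  shows "\<exists>K. \<forall>a. \<forall>b\<in>B. \<bar>a b\<bar> \<le> K * norm (\<Sum>c\<in>B. a c *\<^sub>R c)"
proof -
  define box where "box A = (\<lambda>a. \<Sum>b\<in>A. a b *\<^sub>R b) ` {a. \<forall>b\<in>A. \<bar>a b\<bar> \<le> (1::real)}" for A :: "'a set"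
  define shell where "shell = (\<Union>b\<in>B. \<Union>s\<in>{-1,1::real}. (+) (s *\<^sub>R b) ` box (B - {b}))"
  have "compact shell"
    unfolding shell_def box_def using assms(1)
    by (intro compact_UN compact_translation compact_coefficient_box) auto
  moreover have "0 \<notin> shell"
  proof
    assume "0 \<in> shell"
    then obtain b s where bs: "b \<in> B" "s \<in> {-1, 1::real}" "0 \<in> (+) (s *\<^sub>R b) ` box (B - {b})"
      unfolding shell_def by blast
    then obtain a where b: "b \<in> B" "s = -1 \<or> s = (1::real)"
      "0 = s *\<^sub>R b + (\<Sum>c\<in>B - {b}. a c *\<^sub>R c)"
      unfolding box_def by blast
    have "(\<Sum>c\<in>B - {b}. a c *\<^sub>R c) \<in> span (B - {b})"
      by (intro span_sum span_scale span_base)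
    moreover have "b = (- s) *\<^sub>R (\<Sum>c\<in>B - {b}. a c *\<^sub>R c)"
    proof -
      have "s *\<^sub>R b = - (\<Sum>c\<in>B - {b}. a c *\<^sub>R c)"
        by (simp only: eq_neg_iff_add_eq_0 b(3)[symmetric])
      moreover have "b = s *\<^sub>R (s *\<^sub>R b)" using b(2) by auto
      ultimately show ?thesis by simp
    qed
    ultimately have "b \<in> span (B - {b})" by (metis span_scale)
    then show False using assms(2) b(1) unfolding dependent_def by blast
  qed
  ultimately have "open (- shell)" "0 \<in> - shell" using compact_imp_closed by auto
  then obtain \<delta> where \<delta>: "\<delta> > 0" "ball 0 \<delta> \<subseteq> - shell" by (rule openE)
  show ?thesis
  proof (intro exI[of _ "1/\<delta>"] allI ballI)
    fix a :: "'a \<Rightarrow> real" and b assume b: "b \<in> B"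
    define m where "m = Max ((\<lambda>c. \<bar>a c\<bar>) ` B)"
    have le: "\<bar>a c\<bar> \<le> m" if "c \<in> B" for c
      using that assms(1) by (auto simp: m_def)
    have "m \<in> (\<lambda>c. \<bar>a c\<bar>) ` B" unfolding m_def using b assms(1) by (intro Max_in) auto
    then obtain c0 where c0: "c0 \<in> B" "m = \<bar>a c0\<bar>" by auto
    show "\<bar>a b\<bar> \<le> 1/\<delta> * norm (\<Sum>c\<in>B. a c *\<^sub>R c)"
    proof (cases "m = 0")
      case True then show ?thesis using le[OF b] \<delta>(1) by (simp add: order_trans)
    next
      case False
      then have m: "m > 0" using c0(2) by simp
      have "(1/m) *\<^sub>R (\<Sum>c\<in>B. a c *\<^sub>R c) = (\<Sum>c\<in>B. (a c / m) *\<^sub>R c)"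
        by (simp add: scaleR_sum_right)
      also have "\<dots> = (a c0 / m) *\<^sub>R c0 + (\<Sum>c\<in>B - {c0}. (a c / m) *\<^sub>R c)"
        using sum.remove[OF assms(1) c0(1)] by blast
      also have "\<dots> \<in> shell"
      proof -
        have "a c0 / m \<in> {-1, 1}" using c0(2) m by (auto simp: abs_if split: if_splits)
        moreover have "(\<Sum>c\<in>B - {c0}. (a c / m) *\<^sub>R c) \<in> box (B - {c0})"
          unfolding box_def using le m by (intro image_eqI[where x="\<lambda>c. a c / m"]) auto
        ultimately show ?thesis unfolding shell_def using c0(1) by blast
      qed
      finally have "norm ((1/m) *\<^sub>R (\<Sum>c\<in>B. a c *\<^sub>R c)) \<ge> \<delta>" using \<delta>(2)
        by (force simp: subset_iff not_le[symmetric])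
      then have "m \<le> 1/\<delta> * norm (\<Sum>c\<in>B. a c *\<^sub>R c)" using m \<delta>(1) by (simp add: field_simps)
      then show ?thesis using le[OF b] by linarith
    qed
  qed
qed

text \<open>A finite spanning family together with continuous coordinate functionals: the form in which
  finite dimension enters the calculus below, where vectors are expanded and the expansions
  differentiated or estimated term by term.\<close>

locale finite_coordinates =
  fixes Bs :: "'e::real_normed_vector set" and \<beta> :: "'e \<Rightarrow> 'e \<Rightarrow> real"
  assumes finite_Bs: "finite Bs"
    and bounded_linear_coord: "bounded_linear (\<beta> b)"
    and expand: "(\<Sum>b\<in>Bs. \<beta> b x *\<^sub>R b) = x"

lemma finite_coordinates_exist:
  assumes "finite S" "span S = (UNIV :: 'e::real_normed_vector set)"
  obtains Bs and \<beta> :: "'e::real_normed_vector \<Rightarrow> 'e \<Rightarrow> real" where "finite_coordinates Bs \<beta>"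
proof -
  obtain B where B: "B \<subseteq> S" "independent B" "S \<subseteq> span B"
    using maximal_independent_subset by blast
  have fin: "finite B" using B(1) assms(1) finite_subset by blast
  have "span B = UNIV" using B(3) assms(2) span_mono[of S "span B"] by (simp add: span_span top.extremum_unique)
  then have span: "x \<in> span B" for x by simp
  have expand: "(\<Sum>b\<in>B. representation B x b *\<^sub>R b) = x" for x
    by (rule real_vector.sum_representation_eq[OF B(2) span fin subset_refl])
  obtain K where K: "\<And>a b. b \<in> B \<Longrightarrow> \<bar>a b\<bar> \<le> K * norm (\<Sum>c\<in>B. a c *\<^sub>R c)"
    using coefficient_bound[OF fin B(2)] by blast
  have "bounded_linear (\<lambda>x. representation B x b)" for b
  proof (cases "b \<in> B")
    case True
    show ?thesis
    proof (rule bounded_linear_intro[where K=K])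
      show "norm (representation B x b) \<le> norm x * K" for x
        using K[OF True, of "representation B x"] by (simp add: expand mult.commute)
    qed (simp_all add: real_vector.representation_add[OF B(2)] real_vector.representation_scale[OF B(2)] span)
  next
    case False
    then have "representation B x b = 0" for x using real_vector.representation_ne_zero by blast
    then show ?thesis by (simp add: bounded_linear_zero)
  qed
  then show thesis using that[of B "\<lambda>b x. representation B x b"] fin expand
    by (simp add: finite_coordinates_def)
qed

context finite_coordinates
begin

text \<open>Expanding the argument of a derivative reduces statements about all directions to finitely many.\<close>

lemma linear_expand:
  assumes "linear L" shows "L x = (\<Sum>b\<in>Bs. \<beta> b x *\<^sub>R L b)"
  by (subst expand[of x, symmetric]) (simp add: linear_sum[OF assms] linear_scale[OF assms])

lemma compact_cball_coord: "compact (cball (z::'e) r)"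
proof -
  obtain K where K: "\<And>b. K b > 0" "\<And>b x. norm (\<beta> b x) \<le> norm x * K b"
    by (metis bounded_linear.pos_bounded[OF bounded_linear_coord])
  define C where "C = Max ((\<lambda>b. r * K b) ` Bs)"
  have "cball z r \<subseteq> (+) z ` ((\<lambda>a. \<Sum>b\<in>Bs. a b *\<^sub>R b) ` {a. \<forall>b\<in>Bs. \<bar>a b\<bar> \<le> C})"
  proof
    fix y assume y: "y \<in> cball z r"
    have "\<bar>\<beta> b (y - z)\<bar> \<le> C" if "b \<in> Bs" for b
    proof -
      have "\<bar>\<beta> b (y - z)\<bar> \<le> norm (y - z) * K b" using K(2)[of b "y - z"] by simp
      also have "\<dots> \<le> r * K b"
        using y K(1)[of b] by (intro mult_right_mono) (auto simp: dist_norm norm_minus_commute)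
      also have "\<dots> \<le> C" unfolding C_def using finite_Bs that by (intro Max_ge) auto
      finally show ?thesis .
    qed
    then show "y \<in> (+) z ` ((\<lambda>a. \<Sum>b\<in>Bs. a b *\<^sub>R b) ` {a. \<forall>b\<in>Bs. \<bar>a b\<bar> \<le> C})"
      by (intro image_eqI[where x="y - z"] image_eqI[where x="\<lambda>b. \<beta> b (y - z)"]) (auto simp: expand)
  qed
  from Int_absorb1[OF this]
    compact_Int_closed[OF compact_translation[OF compact_coefficient_box[OF finite_Bs, of C], of z] closed_cball[of z r]]
  show ?thesis by (rule subst)
qed

text \<open>By the chain rule the derivative of the composition in direction \<open>v\<close> is \<open>f'(g x)\<close> applied to a vector
  that moves with \<open>x\<close>. Its expansion in coordinates separates this into products of \<open>C\<^sup>k\<close> functions, to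
  which the induction hypothesis applies.\<close>

lemma Ck_on_compose:
  assumes "open S" "open T" "g ` S \<subseteq> T" "Ck_on k S (g :: 'a::real_normed_vector \<Rightarrow> 'e)" "Ck_on k T f"
  shows "Ck_on k S (\<lambda>x. f (g x))"
  using assms(4,5)
proof (induction k arbitrary: f)
  case 0
  then show ?case using continuous_on_compose2[OF _ _ assms(3)] by simp
next
  case (Suc k)
  let ?f = "\<lambda>y. frechet_derivative f (at y)" and ?g = "\<lambda>x. frechet_derivative g (at x)"
  show ?case
  proof (rule Ck_on_SucI[OF assms(1), where D="\<lambda>x v. \<Sum>b\<in>Bs. \<beta> b (?g x v) *\<^sub>R ?f (g x) b"])
    fix x assume x: "x \<in> S"
    then have gx: "g x \<in> T" using assms(3) by blast
    note df = Ck_on_has_derivative[OF Suc.prems(2) gx]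
    have "((\<lambda>x. f (g x)) has_derivative (\<lambda>v. ?f (g x) (?g x v))) (at x)"
      by (rule has_derivative_compose[OF Ck_on_has_derivative[OF Suc.prems(1) x] df])
    then show "((\<lambda>x. f (g x)) has_derivative (\<lambda>v. \<Sum>b\<in>Bs. \<beta> b (?g x v) *\<^sub>R ?f (g x) b)) (at x)"
      by (simp only: linear_expand[OF has_derivative_linear[OF df], symmetric])
  next
    fix v
    show "Ck_on k S (\<lambda>x. \<Sum>b\<in>Bs. \<beta> b (?g x v) *\<^sub>R ?f (g x) b)"
      by (intro Ck_on_sum Ck_on_scaleR Ck_on_bounded_linear[OF bounded_linear_coord] assms(1)
          Suc.IH[OF Ck_on_SucD[OF Suc.prems(1)]] Ck_on_frechet_derivative Suc.prems)
  qed
qed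

lemma smooth_on_compose:
  assumes "open S" "open T" "g ` S \<subseteq> T" "smooth_on S (g :: 'a::real_normed_vector \<Rightarrow> 'e)" "smooth_on T f"
  shows "smooth_on S (\<lambda>x. f (g x))"
  using Ck_on_compose[OF assms(1-3)] assms(4,5) by (auto simp: smooth_on_def)

lemma bounded_linear_if_linear:
  assumes "linear (L :: 'e \<Rightarrow> 'b::real_normed_vector)" shows "bounded_linear L"
proof -
  have "bounded_linear (\<lambda>x. \<Sum>b\<in>Bs. \<beta> b x *\<^sub>R L b)"
    by (intro bounded_linear_sum bounded_linear_scaleR_left[THEN bounded_linear_compose]
      bounded_linear_coord)
  then show ?thesis by (simp only: linear_expand[OF assms, symmetric])
qed

text \<open>Directional derivatives that are linear in the direction and continuous in the point form a total
  derivative: by the mean value theorem the increment \<open>G y - G z\<close> is a directional derivative at an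
  intermediate point, and continuity in the finitely many directions \<open>b \<in> Bs\<close> is uniform in all directions.\<close>

lemma has_derivative_if_directional:
  fixes G :: "'e \<Rightarrow> real"
  assumes "open U" "z \<in> U"
    and D: "\<And>z v. z \<in> U \<Longrightarrow> ((\<lambda>s. G (z + s *\<^sub>R v)) has_real_derivative G' z v) (at 0)"
    and lin: "\<And>z. z \<in> U \<Longrightarrow> linear (G' z)"
    and cont: "\<And>v. continuous_on U (\<lambda>z. G' z v)"
  shows "(G has_derivative G' z) (at z)"
  unfolding has_derivative_at_alt
proof (intro conjI allI impI)
  show "bounded_linear (G' z)" by (rule bounded_linear_if_linear[OF lin[OF assms(2)]])
  fix e :: real assume e: "e > 0"
  obtain K0 where K0: "\<And>b. K0 b > 0" "\<And>b x. norm (\<beta> b x) \<le> norm x * K0 b"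
    by (metis bounded_linear.pos_bounded[OF bounded_linear_coord])
  define K where "K = (\<Sum>b\<in>Bs. K0 b) + 1"
  have K: "K > 0" using K0(1) by (simp add: K_def sum_nonneg add_nonneg_pos less_imp_le)
  have "\<forall>\<^sub>F w in nhds z. \<bar>G' w b - G' z b\<bar> < e / K" for b
  proof -
    have "isCont (\<lambda>w. G' w b) z" by (metis cont assms(1,2) continuous_on_eq_continuous_at)
    then have "((\<lambda>w. G' w b) \<longlongrightarrow> G' z b) (nhds z)"
      by (simp only: isCont_def tendsto_at_iff_tendsto_nhds[of "\<lambda>w. G' w b" z])
    from tendstoD[OF this, of "e / K"] show ?thesis using e K by (simp only: dist_real_def) simp
  qed
  then have "\<forall>\<^sub>F w in nhds z. w \<in> U \<and> (\<forall>b\<in>Bs. \<bar>G' w b - G' z b\<bar> < e / K)"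
    by (intro eventually_conj eventually_nhds_in_open assms(1,2) eventually_ball_finite finite_Bs) blast
  then obtain d where d: "d > 0"
    "\<And>w. dist w z < d \<Longrightarrow> w \<in> U" "\<And>w b. dist w z < d \<Longrightarrow> b \<in> Bs \<Longrightarrow> \<bar>G' w b - G' z b\<bar> < e / K"
    unfolding eventually_nhds_metric by blast
  show "\<exists>d>0. \<forall>y. norm (y - z) < d \<longrightarrow> norm (G y - G z - G' z (y - z)) \<le> e * norm (y - z)"
  proof (intro exI[of _ d] conjI allI impI d(1))
    fix y assume y: "norm (y - z) < d"
    define w where "w = y - z"
    have near: "dist (z + s *\<^sub>R w) z < d" if "0 \<le> s" "s \<le> 1" for s
    proof -
      have "dist (z + s *\<^sub>R w) z = s * norm w" using that by (simp add: dist_norm)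
      also have "\<dots> \<le> 1 * norm w" by (rule mult_right_mono) (use that in auto)
      finally show ?thesis using y by (simp add: w_def)
    qed
    have "((\<lambda>s. G (z + s *\<^sub>R w)) has_real_derivative G' (z + s *\<^sub>R w) w) (at s)"
      if "0 \<le> s" "s \<le> 1" for s
    proof -
      have "((\<lambda>x. G (z + (x + s) *\<^sub>R w)) has_real_derivative G' (z + s *\<^sub>R w) w) (at 0)"
        using D[OF d(2)[OF near[OF that]], of w] by (simp add: algebra_simps)
      then show ?thesis using DERIV_shift[of "\<lambda>s. G (z + s *\<^sub>R w)" _ 0 s] by simp
    qed
    from MVT2[OF _ this, of 0 1] obtain \<theta> where \<theta>: "0 < \<theta>" "\<theta> < 1"
      "G (z + 1 *\<^sub>R w) - G (z + 0 *\<^sub>R w) = (1 - 0) * G' (z + \<theta> *\<^sub>R w) w" by auto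
    define p where "p = z + \<theta> *\<^sub>R w"
    have p: "dist p z < d" using near[of \<theta>] \<theta> by (simp add: p_def)
    have "G y - G z - G' z w = G' p w - G' z w" using \<theta>(3) by (simp add: p_def w_def)
    also have "\<dots> = (\<Sum>b\<in>Bs. \<beta> b w * (G' p b - G' z b))"
      using linear_expand[OF lin[OF d(2)[OF p]], of w] linear_expand[OF lin[OF assms(2)], of w]
      by (simp add: sum_subtractf right_diff_distrib)
    also have "\<bar>\<dots>\<bar> \<le> (\<Sum>b\<in>Bs. norm w * K0 b * (e / K))"
    proof (rule order_trans[OF sum_abs], rule sum_mono)
      fix b assume b: "b \<in> Bs"
      show "\<bar>\<beta> b w * (G' p b - G' z b)\<bar> \<le> norm w * K0 b * (e / K)"
        unfolding abs_mult using d(3)[OF p b] K0(2)[of b w] K0(1)[of b] by (intro mult_mono) auto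
    qed
    also have "\<dots> = norm w * (e / K) * (\<Sum>b\<in>Bs. K0 b)"
      unfolding sum_distrib_left by (intro sum.cong refl) (simp only: mult_ac)
    also have "\<dots> \<le> norm w * (e / K) * K"
      using e K by (intro mult_left_mono) (auto simp: K_def)
    also have "\<dots> = e * norm w" using K by simp
    finally show "norm (G y - G z - G' z (y - z)) \<le> e * norm (y - z)" by (simp add: w_def)
  qed
qed

end

section \<open>Hadamard's lemma and bump functions\<close>

text \<open>The weighted mean of \<open>F\<close> on the segment from \<open>q\<close> to \<open>y\<close>. With \<open>k = 0\<close> it produces the quotients in
  Hadamard's lemma; each differentiation in \<open>y\<close> brings out one more factor \<open>t\<close>, which is why the
  weights \<open>t\<^sup>k\<close> are there.\<close>

definition radial_mean :: "nat \<Rightarrow> 'e::real_normed_vector \<Rightarrow> ('e \<Rightarrow> real) \<Rightarrow> 'e \<Rightarrow> real" where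
  "radial_mean k q F y = integral {0..1} (\<lambda>t. t ^ k * F (q + t *\<^sub>R (y - q)))"

lemma segment_in_convex:
  assumes "convex U" "q \<in> U" "y \<in> U" "0 \<le> t" "t \<le> 1" shows "q + t *\<^sub>R (y - q) \<in> U"
proof -
  have "(1 - t) *\<^sub>R q + t *\<^sub>R y \<in> U" using assms by (intro convexD) auto
  then show ?thesis by (simp add: algebra_simps)
qed

lemma continuous_on_radial_integrand:
  fixes F :: "'e::real_normed_vector \<Rightarrow> real"
  assumes "convex U" "q \<in> U" "continuous_on U F"
  shows "continuous_on (U \<times> {0..1}) (\<lambda>(y, t). t ^ k * F (q + t *\<^sub>R (y - q)))"
proof -
  have "continuous_on (U \<times> {0..1::real}) (\<lambda>p. F (q + snd p *\<^sub>R (fst p - q)))"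
  proof (rule continuous_on_compose2[OF assms(3)])
    show "continuous_on (U \<times> {0..1::real}) (\<lambda>p. q + snd p *\<^sub>R (fst p - q))"
      by (intro continuous_intros)
  qed (auto intro: segment_in_convex assms(1,2))
  then show ?thesis unfolding split_beta by (intro continuous_intros)
qed

lemma radial_integrand_integrable:
  fixes F :: "'e::real_normed_vector \<Rightarrow> real"
  assumes "convex U" "q \<in> U" "continuous_on U F" "y \<in> U"
  shows "(\<lambda>t. t ^ k * F (q + t *\<^sub>R (y - q))) integrable_on {0..1}"
proof (rule integrable_continuous_interval)
  have "continuous_on {0..1} (\<lambda>t. (\<lambda>(y, t). t ^ k * F (q + t *\<^sub>R (y - q))) (y, t))"
    by (rule continuous_on_compose2[OF continuous_on_radial_integrand[OF assms(1-3)]])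
      (use assms(4) in \<open>auto intro!: continuous_intros\<close>)
  then show "continuous_on {0..1} (\<lambda>t. t ^ k * F (q + t *\<^sub>R (y - q)))" by simp
qed

lemma continuous_on_radial_mean:
  assumes "convex U" "q \<in> U" "continuous_on U F"
  shows "continuous_on U (radial_mean k q F)"
  using integral_continuous_on_param[of U 0 "1::real" "\<lambda>y t. t ^ k * F (q + t *\<^sub>R (y - q))"]
    continuous_on_radial_integrand[OF assms] by (simp add: radial_mean_def[abs_def])

text \<open>Differentiation under the integral along one line at a time, where the parameter is a real number.
  The total derivative is recovered afterwards from the directional ones.\<close>

lemma radial_mean_directional_derivative:
  assumes "open U" "convex U" "q \<in> U" "Ck_on 1 U F" "y \<in> U"
  shows "((\<lambda>s. radial_mean k q F (y + s *\<^sub>R v)) has_real_derivative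
    radial_mean (Suc k) q (\<lambda>z. frechet_derivative F (at z) v) y) (at 0)"
proof -
  let ?F = "\<lambda>z. frechet_derivative F (at z) v"
  have C1: "Ck_on (Suc 0) U F" using assms(4) by simp
  have "open ((\<lambda>s. y + s *\<^sub>R v) -` U)"
    by (intro open_vimage assms(1) continuous_intros)
  moreover have "0 \<in> (\<lambda>s. y + s *\<^sub>R v) -` U" using assms(5) by simp
  ultimately obtain d where d: "d > 0" "ball 0 d \<subseteq> (\<lambda>s. y + s *\<^sub>R v) -` U"
    using open_contains_ball by metis
  then have inU: "y + s *\<^sub>R v \<in> U" if "s \<in> ball 0 d" for s using that by auto
  have contF: "continuous_on U F" "continuous_on U ?F"
    using Ck_on_SucD[OF C1] Ck_on_frechet_derivative[OF C1] by simp_all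
  have "((\<lambda>s. integral (cbox 0 1) (\<lambda>t. t ^ k * F (q + t *\<^sub>R (y + s *\<^sub>R v - q)))) has_real_derivative
    integral (cbox 0 1) (\<lambda>t. t ^ Suc k * ?F (q + t *\<^sub>R (y + 0 *\<^sub>R v - q)))) (at 0 within ball 0 d)"
  proof (rule leibniz_rule_field_derivative[where f="\<lambda>s t. t ^ k * F (q + t *\<^sub>R (y + s *\<^sub>R v - q))"
        and fx="\<lambda>s t. t ^ Suc k * ?F (q + t *\<^sub>R (y + s *\<^sub>R v - q))"])
    fix s t :: real assume s: "s \<in> ball 0 d" and t: "t \<in> cbox 0 1"
    have seg: "q + t *\<^sub>R (y + s *\<^sub>R v - q) = (q + t *\<^sub>R (y - q)) + s *\<^sub>R (t *\<^sub>R v)" for s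
      by (simp add: algebra_simps)
    have "q + t *\<^sub>R (y + s *\<^sub>R v - q) \<in> U"
      using segment_in_convex[OF assms(2,3) inU[OF s]] t by simp
    then have D: "(F has_derivative frechet_derivative F (at ((q + t *\<^sub>R (y - q)) + s *\<^sub>R (t *\<^sub>R v))))
        (at ((q + t *\<^sub>R (y - q)) + s *\<^sub>R (t *\<^sub>R v)))"
      unfolding seg by (rule Ck_on_has_derivative[OF C1])
    show "((\<lambda>s. t ^ k * F (q + t *\<^sub>R (y + s *\<^sub>R v - q))) has_real_derivative
        t ^ Suc k * ?F (q + t *\<^sub>R (y + s *\<^sub>R v - q))) (at s within ball 0 d)"
      using DERIV_cmult[OF has_derivative_line[OF D], of "t ^ k" "ball 0 d"]
      unfolding seg linear_scale[OF has_derivative_linear[OF D]] by (simp add: mult_ac)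
  next
    fix s :: real assume "s \<in> ball 0 d"
    then show "(\<lambda>t. t ^ k * F (q + t *\<^sub>R (y + s *\<^sub>R v - q))) integrable_on cbox 0 1"
      using radial_integrand_integrable[OF assms(2,3) contF(1) inU] by simp
  next
    have "continuous_on (ball 0 d \<times> cbox 0 1)
      (\<lambda>p. (\<lambda>(y, t). t ^ Suc k * ?F (q + t *\<^sub>R (y - q))) (y + fst p *\<^sub>R v, snd p))"
      by (rule continuous_on_compose2[OF continuous_on_radial_integrand[OF assms(2,3) contF(2)]])
        (use inU in \<open>auto intro!: continuous_intros\<close>)
    then show "continuous_on (ball 0 d \<times> cbox 0 1)
      (\<lambda>(s :: real, t :: real). t ^ Suc k * ?F (q + t *\<^sub>R (y + s *\<^sub>R v - q)))" by (simp add: split_beta)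
  qed (use d(1) in auto)
  then show ?thesis
    using d(1) by (simp add: radial_mean_def at_within_open[of 0 "ball 0 d"])
qed

context finite_coordinates
begin

lemma Ck_on_radial_mean:
  fixes F :: "'e \<Rightarrow> real"
  assumes "open U" "convex U" "q \<in> U" "Ck_on n U F"
  shows "Ck_on n U (radial_mean k q F)"
  using assms(4)
proof (induction n arbitrary: F k)
  case 0 then show ?case using continuous_on_radial_mean[OF assms(2,3)] by simp
next
  case (Suc n)
  let ?F = "\<lambda>v z. frechet_derivative F (at z) v"
  have Ck_le: "Ck_on m U f" if "Ck_on (m + j) U f" for m j and f :: "'e \<Rightarrow> real"
    using that by (induction j) (auto dest: Ck_on_SucD)
  have C1: "Ck_on 1 U F" using Ck_le[of 1 n] Suc.prems by simp
  have cont: "continuous_on U (?F v)" for v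
    using Ck_on_frechet_derivative[of 0 U F v] C1 by simp
  show ?case
  proof (rule Ck_on_SucI[OF assms(1), where D="\<lambda>y v. radial_mean (Suc k) q (?F v) y"])
    fix y assume y: "y \<in> U"
    show "(radial_mean k q F has_derivative (\<lambda>v. radial_mean (Suc k) q (?F v) y)) (at y)"
    proof (rule has_derivative_if_directional[OF assms(1) y])
      fix z assume z: "z \<in> U"
      show "((\<lambda>s. radial_mean k q F (z + s *\<^sub>R v)) has_real_derivative
          radial_mean (Suc k) q (?F v) z) (at 0)" for v
        by (rule radial_mean_directional_derivative[OF assms(1-3) C1 z])
      have lin: "linear (frechet_derivative F (at (q + t *\<^sub>R (z - q))))" if "t \<in> {0..1}" for t
        using Ck_on_has_derivative[OF C1[unfolded One_nat_def] segment_in_convex[OF assms(2,3) z]] that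
        by (auto intro: has_derivative_linear)
      show "linear (\<lambda>v. radial_mean (Suc k) q (?F v) z)"
      proof (rule linearI)
        fix v w
        have "integral {0..1} (\<lambda>t. t ^ Suc k * ?F (v + w) (q + t *\<^sub>R (z - q))) =
          integral {0..1} (\<lambda>t. t ^ Suc k * ?F v (q + t *\<^sub>R (z - q)) + t ^ Suc k * ?F w (q + t *\<^sub>R (z - q)))"
          by (rule integral_cong) (simp add: linear_add[OF lin] distrib_left)
        also have "\<dots> = integral {0..1} (\<lambda>t. t ^ Suc k * ?F v (q + t *\<^sub>R (z - q))) +
            integral {0..1} (\<lambda>t. t ^ Suc k * ?F w (q + t *\<^sub>R (z - q)))"
          by (intro integral_add radial_integrand_integrable[OF assms(2,3) cont z])
        finally show "radial_mean (Suc k) q (?F (v + w)) z =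
            radial_mean (Suc k) q (?F v) z + radial_mean (Suc k) q (?F w) z"
          by (simp only: radial_mean_def)
      next
        fix c v
        have "integral {0..1} (\<lambda>t. t ^ Suc k * ?F (c *\<^sub>R v) (q + t *\<^sub>R (z - q))) =
          integral {0..1} (\<lambda>t. c * (t ^ Suc k * ?F v (q + t *\<^sub>R (z - q))))"
          by (rule integral_cong) (simp add: linear_scale[OF lin])
        then show "radial_mean (Suc k) q (?F (c *\<^sub>R v)) z = c *\<^sub>R radial_mean (Suc k) q (?F v) z"
          by (simp only: radial_mean_def integral_mult_right real_scaleR_def)
      qed
    next
      show "continuous_on U (\<lambda>z. radial_mean (Suc k) q (?F v) z)" for v
        by (rule continuous_on_radial_mean[OF assms(2,3) cont])
    qed
  next
    show "Ck_on n U (\<lambda>y. radial_mean (Suc k) q (?F v) y)" for v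
      by (rule Suc.IH[OF Ck_on_frechet_derivative[OF Suc.prems]])
  qed
qed

text \<open>A smooth function is its value at \<open>q\<close> plus a combination of coordinates that vanish at \<open>q\<close> with smooth
  coefficients. The coefficients are the radial means of the partial derivatives, by the fundamental
  theorem of calculus on the segment from \<open>q\<close>. This is what forces a derivation at \<open>q\<close> to depend only
  on the first derivatives.\<close>

lemma smooth_hadamard:
  fixes F :: "'e \<Rightarrow> real"
  assumes "open U" "convex U" "q \<in> U" "smooth_on U F"
  obtains G where "\<forall>b. smooth_on U (G b)" "\<forall>b. G b q = frechet_derivative F (at q) b"
    "\<forall>y\<in>U. F y = F q + (\<Sum>b\<in>Bs. \<beta> b (y - q) * G b y)"
proof
  let ?F = "\<lambda>b z. frechet_derivative F (at z) b"
  let ?G = "\<lambda>b. radial_mean 0 q (?F b)"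
  show "\<forall>b. smooth_on U (?G b)"
    using smooth_on_frechet_derivative[OF assms(4)] Ck_on_radial_mean[OF assms(1-3)]
    by (auto simp: smooth_on_def)
  show "\<forall>b. ?G b q = ?F b q" by (simp add: radial_mean_def)
  show "\<forall>y\<in>U. F y = F q + (\<Sum>b\<in>Bs. \<beta> b (y - q) * ?G b y)"
  proof
    fix y assume y: "y \<in> U"
    have D: "(F has_derivative frechet_derivative F (at (q + t *\<^sub>R (y - q)))) (at (q + t *\<^sub>R (y - q)))"
      if "0 \<le> t" "t \<le> 1" for t
      by (rule smooth_on_has_derivative[OF assms(4) segment_in_convex[OF assms(2,3) y that]])
    have "((\<lambda>t. F (q + t *\<^sub>R (y - q))) has_vector_derivative ?F (y - q) (q + t *\<^sub>R (y - q))) (at t within {0..1})"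
      if "t \<in> {0..1}" for t
      using has_derivative_line[OF D] that by (auto simp: has_real_derivative_iff_has_vector_derivative)
    from fundamental_theorem_of_calculus[OF _ this]
    have "((\<lambda>t. ?F (y - q) (q + t *\<^sub>R (y - q))) has_integral F y - F q) {0..1}" by simp
    then have "F y - F q = integral {0..1} (\<lambda>t. ?F (y - q) (q + t *\<^sub>R (y - q)))"
      by (simp add: integral_unique)
    also have "\<dots> = integral {0..1} (\<lambda>t. \<Sum>b\<in>Bs. \<beta> b (y - q) * (t ^ 0 * ?F b (q + t *\<^sub>R (y - q))))"
      by (rule integral_cong) (subst linear_expand[OF has_derivative_linear[OF D]], auto)
    also have "\<dots> = (\<Sum>b\<in>Bs. integral {0..1} (\<lambda>t. \<beta> b (y - q) * (t ^ 0 * ?F b (q + t *\<^sub>R (y - q)))))"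
      by (intro integral_sum finite_Bs integrable_on_mult_right radial_integrand_integrable[OF assms(2,3) _ y]
        smooth_on_continuous[OF smooth_on_frechet_derivative[OF assms(4)]])
    also have "\<dots> = (\<Sum>b\<in>Bs. \<beta> b (y - q) * ?G b y)"
      by (simp only: integral_mult_right radial_mean_def)
    finally show "F y = F q + (\<Sum>b\<in>Bs. \<beta> b (y - q) * ?G b y)" by simp
  qed
qed

lemma smooth_on_coord_offset: "open S \<Longrightarrow> smooth_on S (\<lambda>x. \<beta> b (x - z))"
proof -
  assume S: "open S"
  have "smooth_on S (\<lambda>x. \<beta> b x + (- \<beta> b z))"
    by (intro smooth_on_add smooth_on_const smooth_on_bounded_linear bounded_linear_coord S)
  then show ?thesis
    by (simp add: linear_diff[OF bounded_linear.linear[OF bounded_linear_coord]])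
qed

text \<open>The norm need not be smooth, so the cutoff is a function of the sum of squared coordinates of \<open>x - z\<close>,
  which controls the norm.\<close>

lemma smooth_bump:
  assumes "r > 0"
  obtains \<rho> :: "'e \<Rightarrow> real" where "smooth_on UNIV \<rho>" "\<rho> z = 1" "\<forall>x. \<rho> x \<noteq> 0 \<longrightarrow> x \<in> cball z r"
proof
  define N where "N = (\<Sum>b\<in>Bs. norm b) + 1"
  have N: "N > 0" by (simp add: N_def sum_nonneg add_nonneg_pos)
  define \<epsilon> where "\<epsilon> = (r / N)\<^sup>2"
  have \<epsilon>: "\<epsilon> > 0" using assms N by (simp add: \<epsilon>_def)
  define Q where "Q x = (\<Sum>b\<in>Bs. \<beta> b (x - z) * \<beta> b (x - z))" for x
  define \<rho> where "\<rho> x = inverse (flat_exp 0 \<epsilon>) * flat_exp 0 (\<epsilon> + (-1) * Q x)" for x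
  have smQ: "smooth_on UNIV (\<lambda>x. \<epsilon> + (-1) * Q x)"
    unfolding Q_def
    by (intro smooth_on_add smooth_on_const smooth_on_mult smooth_on_sum smooth_on_coord_offset open_UNIV)
  \<comment> \<open>compositions with outer functions on the real line\<close>
  interpret real: finite_coordinates "{1::real}" "\<lambda>b x. x"
    by (rule finite_coordinates.intro) (auto simp: bounded_linear_ident)
  have "smooth_on UNIV (\<lambda>x. flat_exp 0 (\<epsilon> + (-1) * Q x))"
    by (rule real.smooth_on_compose[where T=UNIV, OF _ _ _ smQ]) (auto simp: smooth_on_def Ck_on_flat_exp)
  then show "smooth_on UNIV \<rho>"
    unfolding \<rho>_def by (intro smooth_on_mult smooth_on_const open_UNIV)
  have "Q z = 0" by (simp add: Q_def linear_0[OF bounded_linear.linear[OF bounded_linear_coord]])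
  then show "\<rho> z = 1" using \<epsilon> by (simp add: \<rho>_def flat_exp_def)
  show "\<forall>x. \<rho> x \<noteq> 0 \<longrightarrow> x \<in> cball z r"
  proof (intro allI impI)
    fix x assume "\<rho> x \<noteq> 0"
    then have Q: "Q x < \<epsilon>" by (auto simp: \<rho>_def flat_exp_def split: if_splits)
    have "norm (x - z) = norm (\<Sum>b\<in>Bs. \<beta> b (x - z) *\<^sub>R b)" by (simp add: expand)
    also have "\<dots> \<le> (\<Sum>b\<in>Bs. \<bar>\<beta> b (x - z)\<bar> * norm b)"
      by (rule order_trans[OF norm_sum]) simp
    also have "\<dots> \<le> (\<Sum>b\<in>Bs. (r / N) * norm b)"
    proof (intro sum_mono mult_right_mono)
      fix b assume "b \<in> Bs"
      then have "\<beta> b (x - z) * \<beta> b (x - z) \<le> Q x"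
        unfolding Q_def using finite_Bs by (intro member_le_sum) auto
      then have "\<bar>\<beta> b (x - z)\<bar>\<^sup>2 \<le> (r / N)\<^sup>2" using Q by (simp add: \<epsilon>_def power2_eq_square)
      then show "\<bar>\<beta> b (x - z)\<bar> \<le> r / N" by (rule power2_le_imp_le) (use assms N in simp)
    qed auto
    also have "\<dots> = (r / N) * (\<Sum>b\<in>Bs. norm b)" by (simp add: sum_distrib_left)
    also have "\<dots> \<le> (r / N) * N" using assms N by (intro mult_left_mono) (auto simp: N_def)
    also have "\<dots> = r" using N by simp
    finally show "x \<in> cball z r" by (simp add: dist_norm norm_minus_commute)
  qed
qed

end

section \<open>Functions and derivations on a manifold\<close>

context smooth_manifold
begin

lemma chart_open: "(D, \<phi>) \<in> \<A> \<Longrightarrow> open D" "(D, \<phi>) \<in> \<A> \<Longrightarrow> open (\<phi> ` D)"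
  using chart by blast+

lemma chart_homeomorphism: "(D, \<phi>) \<in> \<A> \<Longrightarrow> homeomorphism D (\<phi> ` D) \<phi> (inv_into D \<phi>)"
  by (drule chart) (elim conjE)

lemma chart_continuous:
  "(D, \<phi>) \<in> \<A> \<Longrightarrow> continuous_on D \<phi>" "(D, \<phi>) \<in> \<A> \<Longrightarrow> continuous_on (\<phi> ` D) (inv_into D \<phi>)"
  using homeomorphism_cont1[OF chart_homeomorphism] homeomorphism_cont2[OF chart_homeomorphism] by auto

lemma chart_inverse: "(D, \<phi>) \<in> \<A> \<Longrightarrow> x \<in> D \<Longrightarrow> inv_into D \<phi> (\<phi> x) = x"
  by (rule homeomorphism_apply1[OF chart_homeomorphism])

lemma chart_inj: "(D, \<phi>) \<in> \<A> \<Longrightarrow> inj_on \<phi> D"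
  by (rule inj_on_inverseI[of D "inv_into D \<phi>"]) (rule chart_inverse)

lemma chart_around: obtains D \<phi> where "(D, \<phi>) \<in> \<A>" "p \<in> D"
proof -
  have "p \<in> (\<Union>(D, \<phi>)\<in>\<A>. D)" by (simp only: covers UNIV_I)
  then show thesis using that by auto
qed

lemma chart_open_image:
  assumes "(D, \<phi>) \<in> \<A>" "open V" shows "open (\<phi> ` (D \<inter> V))"
proof -
  have "\<phi> ` (D \<inter> V) = \<phi> ` D \<inter> inv_into D \<phi> -` V"
    using chart_inverse[OF assms(1)] by auto
  then show ?thesis
    using continuous_open_preimage[OF chart_continuous(2)[OF assms(1)] chart_open(2)[OF assms(1)] assms(2)]
    by simp
qed

lemma smooth_fun_const: "smooth_fun \<A> (\<lambda>x. c)"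
  unfolding smooth_fun_def comp_def using chart_open by (auto intro: smooth_on_const)

lemma smooth_fun_add: "smooth_fun \<A> f \<Longrightarrow> smooth_fun \<A> h \<Longrightarrow> smooth_fun \<A> (\<lambda>x. f x + h x)"
  unfolding smooth_fun_def comp_def using chart_open by (auto intro!: smooth_on_add)

lemma smooth_fun_mult: "smooth_fun \<A> f \<Longrightarrow> smooth_fun \<A> h \<Longrightarrow> smooth_fun \<A> (\<lambda>x. f x * h x)"
  unfolding smooth_fun_def comp_def using chart_open by (auto intro!: smooth_on_mult)

lemma smooth_fun_sum: "(\<And>i. i \<in> I \<Longrightarrow> smooth_fun \<A> (f i)) \<Longrightarrow> smooth_fun \<A> (\<lambda>x. \<Sum>i\<in>I. f i x)"
  by (induction I rule: infinite_finite_induct) (auto intro: smooth_fun_const smooth_fun_add)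

lemma smooth_fun_chart:
  "smooth_fun \<A> f \<Longrightarrow> (D, \<phi>) \<in> \<A> \<Longrightarrow> smooth_on (\<phi> ` D) (\<lambda>z. f (inv_into D \<phi> z))"
  unfolding smooth_fun_def comp_def by blast

lemma tangent_add:
  "v \<in> tangent_space \<A> p \<Longrightarrow> smooth_fun \<A> f \<Longrightarrow> smooth_fun \<A> h \<Longrightarrow> v (\<lambda>x. f x + h x) = v f + v h"
  by (simp add: tangent_space_def)

lemma tangent_cmult:
  "v \<in> tangent_space \<A> p \<Longrightarrow> smooth_fun \<A> f \<Longrightarrow> v (\<lambda>x. c * f x) = c * v f"
  by (simp add: tangent_space_def)

lemma tangent_mult:
  "v \<in> tangent_space \<A> p \<Longrightarrow> smooth_fun \<A> f \<Longrightarrow> smooth_fun \<A> h \<Longrightarrow>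
    v (\<lambda>x. f x * h x) = f p * v h + h p * v f"
  by (simp add: tangent_space_def)

lemma tangent_nonsmooth: "v \<in> tangent_space \<A> p \<Longrightarrow> \<not> smooth_fun \<A> f \<Longrightarrow> v f = 0"
  by (simp add: tangent_space_def)

lemma tangent_const:
  assumes "v \<in> tangent_space \<A> p" shows "v (\<lambda>x. c) = 0"
proof -
  have "v (\<lambda>x. 1) = 0"
    using tangent_mult[OF assms smooth_fun_const[of 1] smooth_fun_const[of 1]] by simp
  then show ?thesis using tangent_cmult[OF assms smooth_fun_const[of 1], of c] by simp
qed

lemma tangent_sum:
  assumes "v \<in> tangent_space \<A> p" "\<And>i. i \<in> I \<Longrightarrow> smooth_fun \<A> (f i)"
  shows "v (\<lambda>x. \<Sum>i\<in>I. f i x) = (\<Sum>i\<in>I. v (f i))"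
  using assms(2)
  by (induction I rule: infinite_finite_induct)
    (auto simp: tangent_const[OF assms(1)] tangent_add[OF assms(1)] smooth_fun_sum)

lemma zero_tangent: "(\<lambda>f. 0) \<in> tangent_space \<A> p"
  by (simp add: tangent_space_def)

lemma vector_field_tangent: "vector_field \<A> X \<Longrightarrow> X p \<in> tangent_space \<A> p"
  by (simp add: vector_field_def)

lemma vector_field_smooth: "vector_field \<A> X \<Longrightarrow> smooth_fun \<A> f \<Longrightarrow> smooth_fun \<A> (\<lambda>p. X p f)"
  by (simp add: vector_field_def deriv_along_def)

text \<open>In the product rule for \<open>XY - YX\<close> the mixed first-order terms cancel.\<close>

lemma lie_bracket_tangent:
  assumes "vector_field \<A> X" "vector_field \<A> Y"
  shows "lie_bracket X Y p \<in> tangent_space \<A> p"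
proof -
  note T = vector_field_tangent[OF assms(1)] vector_field_tangent[OF assms(2)]
  note S = vector_field_smooth[OF assms(1)] vector_field_smooth[OF assms(2)]
  note rules = tangent_add[OF T(1)] tangent_add[OF T(2)] tangent_cmult[OF T(1)] tangent_cmult[OF T(2)]
    tangent_mult[OF T(1)] tangent_mult[OF T(2)] tangent_nonsmooth[OF T(1)] tangent_nonsmooth[OF T(2)]
    tangent_const[OF T(1)] tangent_const[OF T(2)]
  show ?thesis
    unfolding tangent_space_def mem_Collect_eq lie_bracket_def deriv_along_def
    by (simp add: rules S smooth_fun_add smooth_fun_mult algebra_simps)
qed

text \<open>Local functions in a chart extend by zero when they vanish off a compact set \<open>K\<close>. Smoothness at a point
  outside of the chart domain needs a neighbourhood on which the extension vanishes: the preimage of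
  \<open>K\<close> is compact, hence closed because the manifold is Hausdorff, and its complement is that
  neighbourhood.\<close>

lemma smooth_fun_extension:
  assumes ch: "(D, \<phi>) \<in> \<A>" and K: "compact K" "K \<subseteq> U" and U: "open U" "U \<subseteq> \<phi> ` D"
    and u: "smooth_on U u" "\<And>z. z \<in> U \<Longrightarrow> z \<notin> K \<Longrightarrow> u z = 0"
  shows "smooth_fun \<A> (\<lambda>x. if x \<in> D \<and> \<phi> x \<in> U then u (\<phi> x) else 0)" (is "smooth_fun \<A> ?f")
  unfolding smooth_fun_def
proof (clarify, rule smooth_on_local)
  fix D' \<phi>' w assume ch': "(D', \<phi>') \<in> \<A>" and "w \<in> \<phi>' ` D'"
  then obtain x where x: "x \<in> D'" "w = \<phi>' x" by blast
  obtain S where S: "finite S" "span S = (UNIV :: 'e set)" using finite_dimensional by blast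
  then obtain Bs and \<beta> :: "'e \<Rightarrow> 'e \<Rightarrow> real" where "finite_coordinates Bs \<beta>"
    using finite_coordinates_exist by blast
  then interpret finite_coordinates Bs \<beta> .
  define P where "P = inv_into D \<phi> ` K"
  have "compact P" unfolding P_def
    using chart_continuous(2)[OF ch] K U continuous_on_subset by (intro compact_continuous_image) blast+
  then have closedP: "closed P" by (rule compact_imp_closed)
  show "\<exists>T. open T \<and> w \<in> T \<and> smooth_on T (?f \<circ> inv_into D' \<phi>')"
  proof (cases "x \<in> D \<and> \<phi> x \<in> U")
    case True
    define V where "V = D \<inter> \<phi> -` U"
    have V: "open V" unfolding V_def
      by (rule continuous_open_preimage[OF chart_continuous(1)[OF ch] chart_open(1)[OF ch] U(1)])
    define T where "T = \<phi>' ` (D' \<inter> V)"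
    have T: "open T" unfolding T_def by (rule chart_open_image[OF ch' V])
    have "smooth_on T (\<lambda>z. u ((\<phi> \<circ> inv_into D' \<phi>') z))"
    proof (rule smooth_on_compose[OF T U(1) _ _ u(1)])
      show "(\<phi> \<circ> inv_into D' \<phi>') ` T \<subseteq> U"
        using chart_inverse[OF ch'] by (auto simp: T_def V_def)
      show "smooth_on T (\<phi> \<circ> inv_into D' \<phi>')"
        by (rule smooth_on_subset[OF compatible[OF ch' ch]]) (auto simp: T_def V_def)
    qed
    moreover have "u ((\<phi> \<circ> inv_into D' \<phi>') z) = (?f \<circ> inv_into D' \<phi>') z" if "z \<in> T" for z
      using that chart_inverse[OF ch'] by (auto simp: T_def V_def)
    ultimately have "smooth_on T (?f \<circ> inv_into D' \<phi>')" by (rule smooth_on_cong[OF T])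
    moreover have "w \<in> T" using x True by (auto simp: T_def V_def)
    ultimately show ?thesis using T by blast
  next
    case False
    define T where "T = \<phi>' ` (D' \<inter> - P)"
    have T: "open T" unfolding T_def using closedP by (intro chart_open_image[OF ch']) auto
    have "x \<notin> P" using False K(2) U(2) by (auto simp: P_def inv_into_into f_inv_into_f subset_iff)
    then have "w \<in> T" using x by (auto simp: T_def)
    moreover have "smooth_on T (?f \<circ> inv_into D' \<phi>')"
    proof (rule smooth_on_cong[OF T smooth_on_const[OF T, of 0]])
      fix z assume "z \<in> T"
      then obtain y where y: "y \<in> D'" "y \<notin> P" "z = \<phi>' y" by (auto simp: T_def)
      have "\<phi> y \<notin> K" if "y \<in> D"
        using y(2) chart_inverse[OF ch that] by (metis P_def image_eqI)
      then show "0 = (?f \<circ> inv_into D' \<phi>') z"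
        using u(2)[of "\<phi> y"] y chart_inverse[OF ch' y(1)] by auto
    qed
    ultimately show ?thesis using T by blast
  qed
qed

end

locale smooth_manifold_coordinates = smooth_manifold \<A> + finite_coordinates Bs \<beta>
  for \<A> :: "('m::{second_countable_topology, t2_space}, 'e::real_normed_vector) atlas"
    and Bs :: "'e set" and \<beta> :: "'e \<Rightarrow> 'e \<Rightarrow> real"

context smooth_manifold_coordinates
begin

text \<open>Multiplication by a fixed bump function \<open>\<rho>\<close> turns every smooth function on the convex neighbourhood \<open>U\<close>
  into a global one. Convexity is for Hadamard's lemma.\<close>

lemma chart_cutoff:
  assumes ch: "(D, \<phi>) \<in> \<A>" and p: "p \<in> D"
  obtains U and \<rho> :: "'e \<Rightarrow> real" where "open U" "convex U" "\<phi> p \<in> U" "U \<subseteq> \<phi> ` D" "smooth_on UNIV \<rho>" "\<rho> (\<phi> p) = 1"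
    "\<forall>u. smooth_on U u \<longrightarrow> smooth_fun \<A> (\<lambda>x. if x \<in> D \<and> \<phi> x \<in> U then \<rho> (\<phi> x) * u (\<phi> x) else 0)"
proof -
  have "\<phi> p \<in> \<phi> ` D" using p by blast
  then obtain r where r: "r > 0" "ball (\<phi> p) r \<subseteq> \<phi> ` D"
    using chart_open(2)[OF ch] open_contains_ball by metis
  obtain \<rho> :: "'e \<Rightarrow> real" where \<rho>: "smooth_on UNIV \<rho>" "\<rho> (\<phi> p) = 1" "\<forall>x. \<rho> x \<noteq> 0 \<longrightarrow> x \<in> cball (\<phi> p) (r/2)"
    by (rule smooth_bump[OF half_gt_zero[OF r(1)], of "\<phi> p"]) (rule that; assumption)
  show thesis
  proof (rule that[of "ball (\<phi> p) r" \<rho>])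
    show "\<forall>u. smooth_on (ball (\<phi> p) r) u \<longrightarrow>
      smooth_fun \<A> (\<lambda>x. if x \<in> D \<and> \<phi> x \<in> ball (\<phi> p) r then \<rho> (\<phi> x) * u (\<phi> x) else 0)"
    proof (intro allI impI)
      fix u :: "'e \<Rightarrow> real" assume u: "smooth_on (ball (\<phi> p) r) u"
      show "smooth_fun \<A> (\<lambda>x. if x \<in> D \<and> \<phi> x \<in> ball (\<phi> p) r then \<rho> (\<phi> x) * u (\<phi> x) else 0)"
      proof (rule smooth_fun_extension[OF ch compact_cball_coord[of "\<phi> p" "r/2"]])
        show "smooth_on (ball (\<phi> p) r) (\<lambda>z. \<rho> z * u z)"
          by (intro smooth_on_mult u smooth_on_subset[OF \<rho>(1)]) auto
      qed (use r \<rho>(3) in auto)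
    qed
  qed (use r \<rho> in auto)
qed

text \<open>Every derivation is a directional derivative in the chart. With \<open>R\<close> the bump function on the manifold
  and \<open>H\<close> the chart expression of \<open>h\<close>, multiplying Hadamard's formula for \<open>H\<close> by \<open>R\<^sup>2\<close> gives an identity of
  globally smooth functions, and the product rule evaluates \<open>v\<close> on both sides, where the terms with
  \<open>v R\<close> cancel.\<close>

lemma tangent_vector_in_chart:
  assumes ch: "(D, \<phi>) \<in> \<A>" and p: "p \<in> D" and v: "v \<in> tangent_space \<A> p"
  obtains \<xi> where "\<forall>h. smooth_fun \<A> h \<longrightarrow>
    v h = frechet_derivative (\<lambda>z. h (inv_into D \<phi> z)) (at (\<phi> p)) \<xi>"
proof -
  obtain U and \<rho> :: "'e \<Rightarrow> real" where U: "open U" "convex U" "\<phi> p \<in> U" "U \<subseteq> \<phi> ` D" and \<rho>: "smooth_on UNIV \<rho>" "\<rho> (\<phi> p) = 1"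
    and ext: "\<forall>u. smooth_on U u \<longrightarrow>
      smooth_fun \<A> (\<lambda>x. if x \<in> D \<and> \<phi> x \<in> U then \<rho> (\<phi> x) * u (\<phi> x) else 0)"
    by (rule chart_cutoff[OF ch p]) (rule that; assumption)
  define E where "E u x = (if x \<in> D \<and> \<phi> x \<in> U then \<rho> (\<phi> x) * u (\<phi> x) else 0)" for u x
  have smE: "smooth_fun \<A> (E u)" if "smooth_on U u" for u
    using ext[rule_format, OF that] by (simp add: E_def[abs_def])
  have Ep: "E u p = u (\<phi> p)" for u using p U(3) \<rho>(2) by (simp add: E_def)
  define R where "R = E (\<lambda>z. 1)"
  have smR: "smooth_fun \<A> R" unfolding R_def by (intro smE smooth_on_const U(1))
  have Rp: "R p = 1" by (simp add: R_def Ep)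
  define y where "y b = E (\<lambda>z. \<beta> b (z - \<phi> p))" for b
  have smy: "smooth_fun \<A> (y b)" for b unfolding y_def by (intro smE smooth_on_coord_offset U(1))
  have yp: "y b p = 0" for b
    by (simp add: y_def Ep linear_0[OF bounded_linear.linear[OF bounded_linear_coord]])
  show thesis
  proof (rule that[of "\<Sum>b\<in>Bs. v (y b) *\<^sub>R b"], intro allI impI)
    fix h assume h: "smooth_fun \<A> h"
    define H where "H z = h (inv_into D \<phi> z)" for z
    have smH: "smooth_on U H"
      using smooth_on_subset[OF smooth_fun_chart[OF h ch] U(4)] by (simp add: H_def[abs_def])
    obtain G where G': "\<forall>b. smooth_on U (G b)" "\<forall>b. G b (\<phi> p) = frechet_derivative H (at (\<phi> p)) b"
      "\<forall>z\<in>U. H z = H (\<phi> p) + (\<Sum>b\<in>Bs. \<beta> b (z - \<phi> p) * G b z)"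
      by (rule smooth_hadamard[OF U(1-3) smH]) (rule that; assumption)
    note G = G'(1,2)[rule_format] bspec[OF G'(3)]
    have Hp: "H (\<phi> p) = h p" by (simp add: H_def chart_inverse[OF ch p])
    \<comment> \<open>one factor \<open>R\<close> for each of the two local factors in every summand\<close>
    have eq: "R x * (R x * h x) = h p * (R x * R x) + (\<Sum>b\<in>Bs. y b x * E (G b) x)" for x
    proof (cases "x \<in> D \<and> \<phi> x \<in> U")
      case True
      have "h x = h p + (\<Sum>b\<in>Bs. \<beta> b (\<phi> x - \<phi> p) * G b (\<phi> x))"
        using G(3)[of "\<phi> x"] True chart_inverse[OF ch, of x] Hp by (simp add: H_def)
      then show ?thesis using True
        by (simp add: R_def y_def E_def algebra_simps sum_distrib_left)
    qed (auto simp: R_def y_def E_def)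
    have RR: "smooth_fun \<A> (\<lambda>x. R x * R x)" by (intro smooth_fun_mult smR)
    have yG: "smooth_fun \<A> (\<lambda>x. y b x * E (G b) x)" for b by (intro smooth_fun_mult smy smE G(1))
    have "v (\<lambda>x. R x * (R x * h x)) = v h + 2 * (h p * v R)"
      by (simp add: tangent_mult[OF v] smR smooth_fun_mult h Rp)
    moreover have "v (\<lambda>x. h p * (R x * R x) + (\<Sum>b\<in>Bs. y b x * E (G b) x)) =
      h p * (2 * v R) + (\<Sum>b\<in>Bs. G b (\<phi> p) * v (y b))"
      by (simp add: tangent_add[OF v] tangent_sum[OF v] smooth_fun_sum smooth_fun_mult smooth_fun_const
        tangent_cmult[OF v] RR yG tangent_mult[OF v] smR smy smE[OF G(1)] Rp yp Ep)
    ultimately have "v h = (\<Sum>b\<in>Bs. G b (\<phi> p) * v (y b))" using eq by simp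
    moreover have lin: "linear (frechet_derivative H (at (\<phi> p)))"
      by (rule has_derivative_linear[OF smooth_on_has_derivative[OF smH U(3)]])
    ultimately have "v h = frechet_derivative H (at (\<phi> p)) (\<Sum>b\<in>Bs. v (y b) *\<^sub>R b)"
      by (simp add: linear_sum[OF lin] linear_scale[OF lin] G(2) mult.commute)
    then show "v h = frechet_derivative (\<lambda>z. h (inv_into D \<phi> z)) (at (\<phi> p)) (\<Sum>b\<in>Bs. v (y b) *\<^sub>R b)"
      by (simp add: H_def[abs_def])
  qed
qed

text \<open>The components of a vector field are smooth near \<open>p\<close>. They would be the values of \<open>X\<close> on the coordinates,
  which are not global functions. On the global functions \<open>\<rho> \<beta>\<^sub>b\<close> and \<open>\<rho>\<close> the field is smooth, and the
  product rule \<open>X(\<rho> \<beta>\<^sub>b) = \<rho> X(\<beta>\<^sub>b) + \<beta>\<^sub>b X(\<rho>)\<close> is solved for \<open>X(\<beta>\<^sub>b)\<close> wherever \<open>\<rho> > 0\<close>.\<close>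

lemma vector_field_in_chart:
  assumes X: "vector_field \<A> X" and ch: "(D, \<phi>) \<in> \<A>" and p: "p \<in> D"
  obtains O' \<omega> where "open O'" "\<phi> p \<in> O'" "O' \<subseteq> \<phi> ` D" "\<forall>b. smooth_on O' (\<omega> b)"
    "\<forall>x h. x \<in> D \<longrightarrow> \<phi> x \<in> O' \<longrightarrow> smooth_fun \<A> h \<longrightarrow>
      X x h = (\<Sum>b\<in>Bs. \<omega> b (\<phi> x) * frechet_derivative (\<lambda>z. h (inv_into D \<phi> z)) (at (\<phi> x)) b)"
proof -
  obtain U and \<rho> :: "'e \<Rightarrow> real" where U: "open U" "convex U" "\<phi> p \<in> U" "U \<subseteq> \<phi> ` D" and \<rho>: "smooth_on UNIV \<rho>" "\<rho> (\<phi> p) = 1"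
    and ext: "\<forall>u. smooth_on U u \<longrightarrow>
      smooth_fun \<A> (\<lambda>x. if x \<in> D \<and> \<phi> x \<in> U then \<rho> (\<phi> x) * u (\<phi> x) else 0)"
    by (rule chart_cutoff[OF ch p]) (rule that; assumption)
  define E where "E u x = (if x \<in> D \<and> \<phi> x \<in> U then \<rho> (\<phi> x) * u (\<phi> x) else 0)" for u x
  have smE: "smooth_fun \<A> (E u)" if "smooth_on U u" for u
    using ext[rule_format, OF that] by (simp add: E_def[abs_def])
  have EU: "\<rho> z * u z = E u (inv_into D \<phi> z)" if "z \<in> U" for u z
    using that U(4) by (auto simp: E_def inv_into_into f_inv_into_f subset_iff)
  define R where "R = E (\<lambda>z. 1)"
  have sm: "smooth_fun \<A> R" "smooth_fun \<A> (E (\<beta> b))" for b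
    unfolding R_def by (intro smE smooth_on_const smooth_on_bounded_linear bounded_linear_coord U(1))+
  define O' where "O' = U \<inter> \<rho> -` {0<..}"
  have openO: "open O'" unfolding O'_def
    using U(1) \<rho>(1) by (intro open_Int open_vimage) (auto simp: smooth_on_continuous)
  \<comment> \<open>the components \<open>X(\<beta>\<^sub>b)\<close>, solved for from the product rule\<close>
  define \<omega> where "\<omega> b z = (X (inv_into D \<phi> z) (E (\<beta> b)) + (- 1) * (\<beta> b z * X (inv_into D \<phi> z) R)) * inverse (\<rho> z)"
    for b z
  have smX: "smooth_on O' (\<lambda>z. X (inv_into D \<phi> z) h)" if "smooth_fun \<A> h" for h
    by (rule smooth_on_subset[OF smooth_fun_chart[OF vector_field_smooth[OF X that] ch]])
      (use U(4) in \<open>auto simp: O'_def\<close>)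
  \<comment> \<open>compositions with outer functions on the real line\<close>
  interpret real: finite_coordinates "{1::real}" "\<lambda>b x. x"
    by (rule finite_coordinates.intro) (auto simp: bounded_linear_ident)
  have sm\<rho>: "smooth_on O' (\<lambda>z. inverse (\<rho> z))"
    by (rule real.smooth_on_compose[where T="{0<..}", OF openO])
      (auto simp: O'_def smooth_on_def Ck_on_inverse intro: smooth_on_subset[OF \<rho>(1), unfolded smooth_on_def, rule_format])
  show thesis
  proof (rule that[of O' \<omega>])
    show "open O'" "\<phi> p \<in> O'" "O' \<subseteq> \<phi> ` D" using openO U \<rho>(2) by (auto simp: O'_def)
    show "\<forall>b. smooth_on O' (\<omega> b)"
      unfolding \<omega>_def
      by (intro allI smooth_on_mult smooth_on_add smooth_on_const smooth_on_bounded_linear bounded_linear_coord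
          openO smX sm sm\<rho>)
    show "\<forall>x h. x \<in> D \<longrightarrow> \<phi> x \<in> O' \<longrightarrow> smooth_fun \<A> h \<longrightarrow>
      X x h = (\<Sum>b\<in>Bs. \<omega> b (\<phi> x) * frechet_derivative (\<lambda>z. h (inv_into D \<phi> z)) (at (\<phi> x)) b)"
    proof (intro allI impI)
      fix x h assume x: "x \<in> D" "\<phi> x \<in> O'" and h: "smooth_fun \<A> h"
      have xU: "\<phi> x \<in> U" and pos: "\<rho> (\<phi> x) > 0" using x(2) by (auto simp: O'_def)
      obtain \<xi> where \<xi>': "\<forall>h. smooth_fun \<A> h \<longrightarrow>
          X x h = frechet_derivative (\<lambda>z. h (inv_into D \<phi> z)) (at (\<phi> x)) \<xi>"
        by (rule tangent_vector_in_chart[OF ch x(1) vector_field_tangent[OF X]]) (rule that; assumption)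
      note \<xi> = \<xi>'[rule_format]
      have der: "X x (E u) = \<rho> (\<phi> x) * u' \<xi> + frechet_derivative \<rho> (at (\<phi> x)) \<xi> * u (\<phi> x)"
        if "(u has_derivative u') (at (\<phi> x))" "smooth_on U u" for u u'
      proof -
        have "((\<lambda>z. \<rho> z * u z) has_derivative
            (\<lambda>v. \<rho> (\<phi> x) * u' v + frechet_derivative \<rho> (at (\<phi> x)) v * u (\<phi> x))) (at (\<phi> x))"
          by (rule has_derivative_mult[OF smooth_on_has_derivative[OF \<rho>(1) UNIV_I] that(1)])
        then have "((\<lambda>z. E u (inv_into D \<phi> z)) has_derivative
            (\<lambda>v. \<rho> (\<phi> x) * u' v + frechet_derivative \<rho> (at (\<phi> x)) v * u (\<phi> x))) (at (\<phi> x))"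
          by (rule has_derivative_transform_within_open[OF _ U(1) xU]) (rule EU)
        from frechet_derivative_at[OF this] \<xi>[OF smE[OF that(2)]] show ?thesis by metis
      qed
      have "X x R = frechet_derivative \<rho> (at (\<phi> x)) \<xi>"
        unfolding R_def using der[OF has_derivative_const smooth_on_const[OF U(1), of 1]] by simp
      moreover have "X x (E (\<beta> b)) = \<rho> (\<phi> x) * \<beta> b \<xi> + frechet_derivative \<rho> (at (\<phi> x)) \<xi> * \<beta> b (\<phi> x)" for b
        by (intro der bounded_linear_imp_has_derivative bounded_linear_coord
            smooth_on_bounded_linear U(1))
      ultimately have \<omega>: "\<omega> b (\<phi> x) = \<beta> b \<xi>" for b
        using pos by (simp add: \<omega>_def chart_inverse[OF ch x(1)] field_simps)
      have "linear (frechet_derivative (\<lambda>z. h (inv_into D \<phi> z)) (at (\<phi> x)))"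
        using smooth_on_has_derivative[OF smooth_fun_chart[OF h ch]] x(1) by (blast intro: has_derivative_linear)
      from linear_expand[OF this, of \<xi>] \<xi>[OF h] \<omega>
      show "X x h = (\<Sum>b\<in>Bs. \<omega> b (\<phi> x) * frechet_derivative (\<lambda>z. h (inv_into D \<phi> z)) (at (\<phi> x)) b)"
        by simp
    qed
  qed
qed

end

lemma (in smooth_manifold) coordinates_exist:
  obtains Bs \<beta> where "smooth_manifold_coordinates \<A> Bs \<beta>"
proof -
  obtain S where S: "finite S" "span S = (UNIV :: 'e set)" using finite_dimensional by blast
  obtain Bs and \<beta> :: "'e \<Rightarrow> 'e \<Rightarrow> real" where "finite_coordinates Bs \<beta>"
    using finite_coordinates_exist[OF S] by blast
  then show thesis
    using that smooth_manifold_axioms by (simp add: smooth_manifold_coordinates_def)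
qed

section \<open>Products of manifolds\<close>

lemma frechet_derivative_slice:
  assumes "(G has_derivative G') (at (z, w))"
  shows "frechet_derivative (\<lambda>z. G (z, w)) (at z) \<xi> = G' (\<xi>, 0)"
    and "frechet_derivative (\<lambda>w. G (z, w)) (at w) \<eta> = G' (0, \<eta>)"
proof -
  have "((\<lambda>z. (z, w)) has_derivative (\<lambda>\<xi>. (\<xi>, 0))) (at z)"
    by (intro has_derivative_Pair has_derivative_ident has_derivative_const)
  from frechet_derivative_at[OF has_derivative_compose[OF this assms]]
  show "frechet_derivative (\<lambda>z. G (z, w)) (at z) \<xi> = G' (\<xi>, 0)" by metis
  have "((\<lambda>w. (z, w)) has_derivative (\<lambda>\<eta>. (0, \<eta>))) (at w)"
    by (intro has_derivative_Pair has_derivative_ident has_derivative_const)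
  from frechet_derivative_at[OF has_derivative_compose[OF this assms]]
  show "frechet_derivative (\<lambda>w. G (z, w)) (at w) \<eta> = G' (0, \<eta>)" by metis
qed

lemma smooth_on_slice:
  assumes "open S" "open T" "smooth_on (S \<times> T) G"
  shows "w \<in> T \<Longrightarrow> smooth_on S (\<lambda>z. G (z, w))" and "z \<in> S \<Longrightarrow> smooth_on T (\<lambda>w. G (z, w))"
proof -
  assume "w \<in> T"
  then show "smooth_on S (\<lambda>z. G (z, w))"
    using smooth_on_affine_compose[OF bounded_linear_Pair[OF bounded_linear_ident bounded_linear_zero]
        assms(1) open_Times[OF assms(1,2)] _ assms(3), of "(0, w)"] by auto
next
  assume "z \<in> S"
  then show "smooth_on T (\<lambda>w. G (z, w))"
    using smooth_on_affine_compose[OF bounded_linear_Pair[OF bounded_linear_zero bounded_linear_ident]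
        assms(2) open_Times[OF assms(1,2)] _ assms(3), of "(z, 0)"] by auto
qed

locale manifold_pair = M: smooth_manifold \<A> + N: smooth_manifold \<B>
  for \<A> :: "('m::{second_countable_topology, t2_space}, 'e::real_normed_vector) atlas"
    and \<B> :: "('n::{second_countable_topology, t2_space}, 'f::real_normed_vector) atlas"
begin

lemma inv_into_prod_chart:
  assumes "(D, \<phi>) \<in> \<A>" "(E, \<psi>) \<in> \<B>" "z \<in> \<phi> ` D" "w \<in> \<psi> ` E"
  shows "inv_into (D \<times> E) (map_prod \<phi> \<psi>) (z, w) = (inv_into D \<phi> z, inv_into E \<psi> w)"
proof (rule inv_into_f_eq)
  show "inj_on (map_prod \<phi> \<psi>) (D \<times> E)"
    using M.chart_inj[OF assms(1)] N.chart_inj[OF assms(2)] by (rule map_prod_inj_on)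
qed (use assms in \<open>auto simp: inv_into_into f_inv_into_f\<close>)

text \<open>Smoothness on a product in terms of the charts of the factors; this removes the inverse of a product
  chart from all later arguments.\<close>

lemma smooth_fun_prod_iff:
  "smooth_fun (prod_atlas \<A> \<B>) f \<longleftrightarrow> (\<forall>D \<phi> E \<psi>. (D, \<phi>) \<in> \<A> \<longrightarrow> (E, \<psi>) \<in> \<B> \<longrightarrow>
    smooth_on (\<phi> ` D \<times> \<psi> ` E) (\<lambda>u. f (inv_into D \<phi> (fst u), inv_into E \<psi> (snd u))))"
proof -
  have eq: "smooth_on (map_prod \<phi> \<psi> ` (D \<times> E)) (f \<circ> inv_into (D \<times> E) (map_prod \<phi> \<psi>)) \<longleftrightarrow>
      smooth_on (\<phi> ` D \<times> \<psi> ` E) (\<lambda>u. f (inv_into D \<phi> (fst u), inv_into E \<psi> (snd u)))" (is "?L \<longleftrightarrow> ?R")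
    if ch: "(D, \<phi>) \<in> \<A>" "(E, \<psi>) \<in> \<B>" for D \<phi> E \<psi>
  proof -
    have op: "open (\<phi> ` D \<times> \<psi> ` E)"
      by (intro open_Times M.chart_open(2)[OF ch(1)] N.chart_open(2)[OF ch(2)])
    have im: "map_prod \<phi> \<psi> ` (D \<times> E) = \<phi> ` D \<times> \<psi> ` E" by (rule map_prod_surj_on) auto
    have eq: "(f \<circ> inv_into (D \<times> E) (map_prod \<phi> \<psi>)) u = f (inv_into D \<phi> (fst u), inv_into E \<psi> (snd u))"
      if "u \<in> \<phi> ` D \<times> \<psi> ` E" for u
      using inv_into_prod_chart[OF ch, of "fst u" "snd u"] that by (simp add: mem_Times_iff)
    show ?thesis unfolding im
      by (rule iffI; erule smooth_on_cong[OF op]) (simp_all only: eq)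
  qed
  have "smooth_fun (prod_atlas \<A> \<B>) f \<longleftrightarrow> (\<forall>D \<phi> E \<psi>. (D, \<phi>) \<in> \<A> \<longrightarrow> (E, \<psi>) \<in> \<B> \<longrightarrow>
    smooth_on (map_prod \<phi> \<psi> ` (D \<times> E)) (f \<circ> inv_into (D \<times> E) (map_prod \<phi> \<psi>)))"
    unfolding smooth_fun_def prod_atlas_def by blast
  then show ?thesis using eq by simp
qed

lemma smooth_fun_prod_chart:
  "smooth_fun (prod_atlas \<A> \<B>) f \<Longrightarrow> (D, \<phi>) \<in> \<A> \<Longrightarrow> (E, \<psi>) \<in> \<B> \<Longrightarrow>
    smooth_on (\<phi> ` D \<times> \<psi> ` E) (\<lambda>u. f (inv_into D \<phi> (fst u), inv_into E \<psi> (snd u)))"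
  by (simp add: smooth_fun_prod_iff)

lemma smooth_fun_slice_fst:
  assumes "smooth_fun (prod_atlas \<A> \<B>) f" shows "smooth_fun \<A> (\<lambda>x. f (x, q))"
  unfolding smooth_fun_def comp_def
proof clarify
  fix D \<phi> assume ch: "(D, \<phi>) \<in> \<A>"
  obtain E \<psi> where ch': "(E, \<psi>) \<in> \<B>" "q \<in> E" by (rule N.chart_around)
  have "\<psi> q \<in> \<psi> ` E" using ch'(2) by blast
  from smooth_on_slice(1)[OF M.chart_open(2)[OF ch] N.chart_open(2)[OF ch'(1)]
      smooth_fun_prod_chart[OF assms ch ch'(1)] this]
  show "smooth_on (\<phi> ` D) (\<lambda>x. f (inv_into D \<phi> x, q))" by (simp add: N.chart_inverse[OF ch'])
qed

lemma smooth_fun_slice_snd: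
  assumes "smooth_fun (prod_atlas \<A> \<B>) f" shows "smooth_fun \<B> (\<lambda>y. f (p, y))"
  unfolding smooth_fun_def comp_def
proof clarify
  fix E \<psi> assume ch: "(E, \<psi>) \<in> \<B>"
  obtain D \<phi> where ch': "(D, \<phi>) \<in> \<A>" "p \<in> D" by (rule M.chart_around)
  have "\<phi> p \<in> \<phi> ` D" using ch'(2) by blast
  from smooth_on_slice(2)[OF M.chart_open(2)[OF ch'(1)] N.chart_open(2)[OF ch]
      smooth_fun_prod_chart[OF assms ch'(1) ch] this]
  show "smooth_on (\<psi> ` E) (\<lambda>y. f (p, inv_into E \<psi> y))" by (simp add: M.chart_inverse[OF ch'])
qed

lemma smooth_fun_pullback_fst:
  assumes "smooth_fun \<A> f" shows "smooth_fun (prod_atlas \<A> \<B>) (\<lambda>u. f (fst u))"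
  unfolding smooth_fun_prod_iff
proof (intro allI impI)
  fix D \<phi> E \<psi> assume ch: "(D, \<phi>) \<in> \<A>" "(E, \<psi>) \<in> \<B>"
  from smooth_on_affine_compose[OF bounded_linear_fst open_Times[OF M.chart_open(2)[OF ch(1)] N.chart_open(2)[OF ch(2)]]
      M.chart_open(2)[OF ch(1)] _ M.smooth_fun_chart[OF assms ch(1)], of 0]
  show "smooth_on (\<phi> ` D \<times> \<psi> ` E)
      (\<lambda>u. f (fst (inv_into D \<phi> (fst u), inv_into E \<psi> (snd u))))" by auto
qed

lemma smooth_fun_pullback_snd:
  assumes "smooth_fun \<B> f" shows "smooth_fun (prod_atlas \<A> \<B>) (\<lambda>u. f (snd u))"
  unfolding smooth_fun_prod_iff
proof (intro allI impI)
  fix D \<phi> E \<psi> assume ch: "(D, \<phi>) \<in> \<A>" "(E, \<psi>) \<in> \<B>"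
  from smooth_on_affine_compose[OF bounded_linear_snd open_Times[OF M.chart_open(2)[OF ch(1)] N.chart_open(2)[OF ch(2)]]
      N.chart_open(2)[OF ch(2)] _ N.smooth_fun_chart[OF assms ch(2)], of 0]
  show "smooth_on (\<phi> ` D \<times> \<psi> ` E)
      (\<lambda>u. f (snd (inv_into D \<phi> (fst u), inv_into E \<psi> (snd u))))" by auto
qed

lemma smooth_fun_prod_mult:
  assumes "smooth_fun (prod_atlas \<A> \<B>) f" "smooth_fun (prod_atlas \<A> \<B>) h"
  shows "smooth_fun (prod_atlas \<A> \<B>) (\<lambda>u. f u * h u)"
  unfolding smooth_fun_prod_iff
proof (intro allI impI)
  fix D \<phi> E \<psi> assume ch: "(D, \<phi>) \<in> \<A>" "(E, \<psi>) \<in> \<B>"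
  show "smooth_on (\<phi> ` D \<times> \<psi> ` E)
    (\<lambda>u. f (inv_into D \<phi> (fst u), inv_into E \<psi> (snd u)) * h (inv_into D \<phi> (fst u), inv_into E \<psi> (snd u)))"
    by (intro smooth_on_mult open_Times M.chart_open(2)[OF ch(1)] N.chart_open(2)[OF ch(2)]
        smooth_fun_prod_chart assms ch)
qed

lemma smooth_fun_swap:
  assumes "smooth_fun (prod_atlas \<A> \<B>) f"
  shows "smooth_fun (prod_atlas \<B> \<A>) (\<lambda>u. f (snd u, fst u))"
proof -
  interpret swapped: manifold_pair \<B> \<A> by unfold_locales
  show ?thesis
    unfolding swapped.smooth_fun_prod_iff
  proof (intro allI impI)
    fix D \<phi> E \<psi> assume ch: "(E, \<psi>) \<in> \<B>" "(D, \<phi>) \<in> \<A>"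
    have "(\<lambda>x. (snd x, fst x) + 0) ` (\<psi> ` E \<times> \<phi> ` D) \<subseteq> \<phi> ` D \<times> \<psi> ` E" by auto
    from smooth_on_affine_compose[OF bounded_linear_Pair[OF bounded_linear_snd bounded_linear_fst]
        open_Times[OF N.chart_open(2)[OF ch(1)] M.chart_open(2)[OF ch(2)]]
        open_Times[OF M.chart_open(2)[OF ch(2)] N.chart_open(2)[OF ch(1)]] this
        smooth_fun_prod_chart[OF assms ch(2,1)]]
    show "smooth_on (\<psi> ` E \<times> \<phi> ` D) (\<lambda>u. f (snd (inv_into E \<psi> (fst u), inv_into D \<phi> (snd u)),
        fst (inv_into E \<psi> (fst u), inv_into D \<phi> (snd u))))" by simp
  qed
qed

text \<open>Differentiating \<open>f\<close> along the fibers keeps it smooth in both variables: near a point it is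
  \<open>\<Sum>\<^sub>b \<omega>\<^sub>b(w) \<partial>\<^sub>b F(z, w)\<close> with smooth components \<open>\<omega>\<^sub>b\<close> of \<open>W\<close>, where \<open>F\<close> is \<open>f\<close> in product coordinates and
  \<open>\<partial>\<^sub>b\<close> its derivative in the direction \<open>(0, b)\<close>.\<close>

lemma smooth_fun_derivative_snd:
  assumes f: "smooth_fun (prod_atlas \<A> \<B>) f" and W: "vector_field \<B> W"
  shows "smooth_fun (prod_atlas \<A> \<B>) (\<lambda>u. W (snd u) (\<lambda>y. f (fst u, y)))"
  unfolding smooth_fun_prod_iff fst_conv snd_conv
proof (intro allI impI, rule smooth_on_local)
  fix D \<phi> E \<psi> u0 assume ch: "(D, \<phi>) \<in> \<A>" "(E, \<psi>) \<in> \<B>" and u0: "u0 \<in> \<phi> ` D \<times> \<psi> ` E"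
  let ?F = "\<lambda>u. f (inv_into D \<phi> (fst u), inv_into E \<psi> (snd u))"
  note smF = smooth_fun_prod_chart[OF f ch]
  obtain q where q: "q \<in> E" "snd u0 = \<psi> q" using u0 by auto
  obtain Bs and \<beta> :: "'f \<Rightarrow> 'f \<Rightarrow> real" where coords: "smooth_manifold_coordinates \<B> Bs \<beta>"
    by (rule N.coordinates_exist)
  obtain O' and \<omega> :: "'f \<Rightarrow> 'f \<Rightarrow> real" where O': "open O'" "\<psi> q \<in> O'" "O' \<subseteq> \<psi> ` E"
    and \<omega>: "\<forall>b. smooth_on O' (\<omega> b)"
    and rep: "\<forall>y h. y \<in> E \<longrightarrow> \<psi> y \<in> O' \<longrightarrow> smooth_fun \<B> h \<longrightarrow>
      W y h = (\<Sum>b\<in>Bs. \<omega> b (\<psi> y) * frechet_derivative (\<lambda>z. h (inv_into E \<psi> z)) (at (\<psi> y)) b)"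
    by (rule smooth_manifold_coordinates.vector_field_in_chart[OF coords W ch(2) q(1)]) (rule that; assumption)
  define T where "T = \<phi> ` D \<times> O'"
  have T: "open T" "T \<subseteq> \<phi> ` D \<times> \<psi> ` E" "u0 \<in> T"
    using O' M.chart_open(2)[OF ch(1)] u0 q(2) by (auto simp: T_def mem_Times_iff intro: open_Times)
  have "smooth_on T (\<lambda>u. \<Sum>b\<in>Bs. \<omega> b (snd u) * frechet_derivative ?F (at u) (0, b))"
  proof (intro smooth_on_sum smooth_on_mult T(1))
    show "smooth_on T (\<lambda>u. \<omega> b (snd u))" for b
      using smooth_on_affine_compose[OF bounded_linear_snd T(1) O'(1) _ \<omega>[rule_format], of 0 b]
      by (auto simp: T_def)
    show "smooth_on T (\<lambda>u. frechet_derivative ?F (at u) (0, b))" for b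
      by (rule smooth_on_subset[OF smooth_on_frechet_derivative[OF smF] T(2)])
  qed
  moreover have "(\<Sum>b\<in>Bs. \<omega> b (snd u) * frechet_derivative ?F (at u) (0, b)) =
      W (inv_into E \<psi> (snd u)) (\<lambda>y. f (inv_into D \<phi> (fst u), y))" if u: "u \<in> T" for u
  proof -
    have w: "snd u \<in> O'" using u by (simp add: T_def mem_Times_iff)
    then have inE: "inv_into E \<psi> (snd u) \<in> E" and inv: "\<psi> (inv_into E \<psi> (snd u)) = snd u"
      using O'(3) by (auto simp: inv_into_into f_inv_into_f subset_iff)
    have "(?F has_derivative frechet_derivative ?F (at u)) (at (fst u, snd u))"
      using smooth_on_has_derivative[OF smF] u T(2) by auto
    from frechet_derivative_slice(2)[OF this]
    show ?thesis
      using rep[rule_format, OF inE _ smooth_fun_slice_snd[OF f, of "inv_into D \<phi> (fst u)"]] w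
      by (simp add: inv)
  qed
  ultimately have "smooth_on T (\<lambda>u. W (inv_into E \<psi> (snd u)) (\<lambda>y. f (inv_into D \<phi> (fst u), y)))"
    by (rule smooth_on_cong[OF T(1)])
  then show "\<exists>T. open T \<and> u0 \<in> T \<and>
      smooth_on T (\<lambda>u. W (inv_into E \<psi> (snd u)) (\<lambda>y. f (inv_into D \<phi> (fst u), y)))"
    using T by blast
qed

lemma smooth_fun_derivative_fst:
  assumes f: "smooth_fun (prod_atlas \<A> \<B>) f" and X: "vector_field \<A> X"
  shows "smooth_fun (prod_atlas \<A> \<B>) (\<lambda>u. X (fst u) (\<lambda>x. f (x, snd u)))"
proof -
  interpret swapped: manifold_pair \<B> \<A> by unfold_locales
  show ?thesis
    using swapped.smooth_fun_swap[OF swapped.smooth_fun_derivative_snd[OF smooth_fun_swap[OF f] X]]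
    by simp
qed

text \<open>At a fixed point both vectors are directional derivatives in charts, so that the two sides are the
  second derivatives of \<open>f\<close> in the directions \<open>(\<xi>, 0)\<close> and \<open>(0, \<eta>)\<close>, taken in either order.\<close>

lemma derivations_commute:
  assumes f: "smooth_fun (prod_atlas \<A> \<B>) f" and X: "vector_field \<A> X" and W: "vector_field \<B> W"
  shows "X p (\<lambda>x. W q (\<lambda>y. f (x, y))) = W q (\<lambda>y. X p (\<lambda>x. f (x, y)))"
proof -
  obtain D \<phi> where ch: "(D, \<phi>) \<in> \<A>" "p \<in> D" by (rule M.chart_around)
  obtain E \<psi> where ch': "(E, \<psi>) \<in> \<B>" "q \<in> E" by (rule N.chart_around)
  let ?F = "\<lambda>u. f (inv_into D \<phi> (fst u), inv_into E \<psi> (snd u))"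
  let ?S = "\<phi> ` D" and ?T = "\<psi> ` E"
  note smF = smooth_fun_prod_chart[OF f ch(1) ch'(1)]
  note op = M.chart_open(2)[OF ch(1)] N.chart_open(2)[OF ch'(1)]
  have pS: "\<phi> p \<in> ?S" and qT: "\<psi> q \<in> ?T" using ch ch' by auto
  obtain Bs and \<beta> :: "'e \<Rightarrow> 'e \<Rightarrow> real" where c: "smooth_manifold_coordinates \<A> Bs \<beta>"
    by (rule M.coordinates_exist)
  obtain \<xi> where \<xi>: "\<forall>h. smooth_fun \<A> h \<longrightarrow>
      X p h = frechet_derivative (\<lambda>z. h (inv_into D \<phi> z)) (at (\<phi> p)) \<xi>"
    by (rule smooth_manifold_coordinates.tangent_vector_in_chart[OF c ch M.vector_field_tangent[OF X]])
      (rule that; assumption)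
  obtain Cs and \<gamma> :: "'f \<Rightarrow> 'f \<Rightarrow> real" where c': "smooth_manifold_coordinates \<B> Cs \<gamma>"
    by (rule N.coordinates_exist)
  obtain \<eta> where \<eta>: "\<forall>h. smooth_fun \<B> h \<longrightarrow>
      W q h = frechet_derivative (\<lambda>w. h (inv_into E \<psi> w)) (at (\<psi> q)) \<eta>"
    by (rule smooth_manifold_coordinates.tangent_vector_in_chart[OF c' ch' N.vector_field_tangent[OF W]])
      (rule that; assumption)
  have dF: "(?F has_derivative frechet_derivative ?F (at u)) (at u)" if "u \<in> ?S \<times> ?T" for u
    by (rule smooth_on_has_derivative[OF smF that])
  have ddF: "((\<lambda>u. frechet_derivative ?F (at u) v) has_derivative
      frechet_derivative (\<lambda>u. frechet_derivative ?F (at u) v) (at u)) (at u)" if "u \<in> ?S \<times> ?T" for u v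
    by (rule smooth_on_has_derivative[OF smooth_on_frechet_derivative[OF smF] that])
  have Wf: "frechet_derivative ?F (at (z, \<psi> q)) (0, \<eta>) = W q (\<lambda>y. f (inv_into D \<phi> z, y))"
    if "z \<in> ?S" for z
    using frechet_derivative_slice(2)[OF dF, of z "\<psi> q" \<eta>] that qT
      \<eta>[rule_format, OF smooth_fun_slice_snd[OF f, of "inv_into D \<phi> z"]] by simp
  have Xf: "frechet_derivative ?F (at (\<phi> p, w)) (\<xi>, 0) = X p (\<lambda>x. f (x, inv_into E \<psi> w))"
    if "w \<in> ?T" for w
    using frechet_derivative_slice(1)[OF dF, of "\<phi> p" w \<xi>] that pS
      \<xi>[rule_format, OF smooth_fun_slice_fst[OF f, of "inv_into E \<psi> w"]] by simp
  have smW: "smooth_fun \<A> (\<lambda>x. W q (\<lambda>y. f (x, y)))"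
    using smooth_fun_slice_fst[OF smooth_fun_derivative_snd[OF f W], of q] by simp
  have smX: "smooth_fun \<B> (\<lambda>y. X p (\<lambda>x. f (x, y)))"
    using smooth_fun_slice_snd[OF smooth_fun_derivative_fst[OF f X], of p] by simp
  have "X p (\<lambda>x. W q (\<lambda>y. f (x, y))) =
      frechet_derivative (\<lambda>z. W q (\<lambda>y. f (inv_into D \<phi> z, y))) (at (\<phi> p)) \<xi>"
    by (rule \<xi>[rule_format, OF smW])
  also have "\<dots> = frechet_derivative (\<lambda>z. frechet_derivative ?F (at (z, \<psi> q)) (0, \<eta>)) (at (\<phi> p)) \<xi>"
  proof -
    have "(\<lambda>z. frechet_derivative ?F (at (z, \<psi> q)) (0, \<eta>)) differentiable at (\<phi> p)"
      using smooth_on_has_derivative[OF smooth_on_slice(1)[OF op smooth_on_frechet_derivative[OF smF] qT] pS]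
      by (rule differentiableI)
    from frechet_derivative_transform_within_open[OF this op(1) pS Wf] show ?thesis by simp
  qed
  also have "\<dots> = frechet_derivative (\<lambda>u. frechet_derivative ?F (at u) (0, \<eta>)) (at (\<phi> p, \<psi> q)) (\<xi>, 0)"
    using pS qT by (intro frechet_derivative_slice(1) ddF) auto
  also have "\<dots> = frechet_derivative (\<lambda>u. frechet_derivative ?F (at u) (\<xi>, 0)) (at (\<phi> p, \<psi> q)) (0, \<eta>)"
    using smF pS qT by (intro symmetric_second_derivative[of "?S \<times> ?T"] open_Times op)
      (auto simp: smooth_on_def)
  also have "\<dots> = frechet_derivative (\<lambda>w. frechet_derivative ?F (at (\<phi> p, w)) (\<xi>, 0)) (at (\<psi> q)) \<eta>"
    using pS qT by (intro frechet_derivative_slice(2)[symmetric] ddF) auto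
  also have "\<dots> = frechet_derivative (\<lambda>w. X p (\<lambda>x. f (x, inv_into E \<psi> w))) (at (\<psi> q)) \<eta>"
  proof -
    have "(\<lambda>w. frechet_derivative ?F (at (\<phi> p, w)) (\<xi>, 0)) differentiable at (\<psi> q)"
      using smooth_on_has_derivative[OF smooth_on_slice(2)[OF op smooth_on_frechet_derivative[OF smF] pS] qT]
      by (rule differentiableI)
    from frechet_derivative_transform_within_open[OF this op(2) qT Xf] show ?thesis by simp
  qed
  also have "\<dots> = W q (\<lambda>y. X p (\<lambda>x. f (x, y)))"
    by (rule \<eta>[rule_format, OF smX, symmetric])
  finally show ?thesis .
qed

section \<open>Lifts of vector fields\<close>

abbreviation "lB \<equiv> lift_fst \<A> \<B>"
abbreviation "lF \<equiv> lift_snd \<A> \<B>"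

lemma lift_fst_apply:
  "lB X (p, q) f = (if smooth_fun (prod_atlas \<A> \<B>) f then X p (\<lambda>x. f (x, q)) else 0)"
  by (simp add: lift_fst_def pushforward_def comp_def)

lemma lift_snd_apply:
  "lF V (p, q) f = (if smooth_fun (prod_atlas \<A> \<B>) f then V q (\<lambda>y. f (p, y)) else 0)"
  by (simp add: lift_snd_def pushforward_def comp_def)

text \<open>The projection to the other factor is constant along the lift, and derivations vanish on constants.\<close>

lemma project_lift_fst:
  assumes "X p \<in> tangent_space \<A> p"
  shows "pushforward \<A> fst (lB X (p, q)) = X p" and "pushforward \<B> snd (lB X (p, q)) = (\<lambda>f. 0)"
  using smooth_fun_pullback_fst M.tangent_nonsmooth[OF assms] M.tangent_const[OF assms]
  by (auto simp: lift_fst_apply pushforward_def comp_def)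

lemma project_lift_snd:
  assumes "V q \<in> tangent_space \<B> q"
  shows "pushforward \<B> snd (lF V (p, q)) = V q" and "pushforward \<A> fst (lF V (p, q)) = (\<lambda>f. 0)"
  using smooth_fun_pullback_snd N.tangent_nonsmooth[OF assms] N.tangent_const[OF assms]
  by (auto simp: lift_snd_apply pushforward_def comp_def)

text \<open>A lift differentiates slice by slice, after a test for smoothness of its argument. In the bracket the
  argument is a derivative along a lift, so the test succeeds because such derivatives are smooth on
  the product. On functions that are not smooth both sides vanish.\<close>

lemma lie_bracket_lift_fst:
  assumes "vector_field \<A> X" "vector_field \<A> Y"
  shows "lie_bracket (lB X) (lB Y) = lB (lie_bracket X Y)"
proof (intro ext)
  fix u :: "'m \<times> 'n" and f
  obtain p q where u: "u = (p, q)" by fastforce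
  show "lie_bracket (lB X) (lB Y) u f = lB (lie_bracket X Y) u f"
  proof (cases "smooth_fun (prod_atlas \<A> \<B>) f")
    case True
    have "deriv_along (lB Z) f = (\<lambda>u. Z (fst u) (\<lambda>x. f (x, snd u)))" for Z
      using True by (auto simp: deriv_along_def lift_fst_apply)
    then show ?thesis using True assms
      by (simp add: u lie_bracket_def lift_fst_apply smooth_fun_derivative_fst)
        (simp add: deriv_along_def)
  next
    case False
    then have "deriv_along (lB Z) f = (\<lambda>u. 0)" for Z
      by (auto simp: deriv_along_def lift_fst_apply)
    then show ?thesis using False assms
      by (simp add: u lie_bracket_def lift_fst_apply M.tangent_const[OF M.vector_field_tangent])
  qed
qed

lemma lie_bracket_lift_snd:
  assumes "vector_field \<B> V" "vector_field \<B> W"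
  shows "lie_bracket (lF V) (lF W) = lF (lie_bracket V W)"
proof (intro ext)
  fix u :: "'m \<times> 'n" and f
  obtain p q where u: "u = (p, q)" by fastforce
  show "lie_bracket (lF V) (lF W) u f = lF (lie_bracket V W) u f"
  proof (cases "smooth_fun (prod_atlas \<A> \<B>) f")
    case True
    have "deriv_along (lF Z) f = (\<lambda>u. Z (snd u) (\<lambda>y. f (fst u, y)))" for Z
      using True by (auto simp: deriv_along_def lift_snd_apply)
    then show ?thesis using True assms
      by (simp add: u lie_bracket_def lift_snd_apply smooth_fun_derivative_snd)
        (simp add: deriv_along_def)
  next
    case False
    then have "deriv_along (lF Z) f = (\<lambda>u. 0)" for Z
      by (auto simp: deriv_along_def lift_snd_apply)
    then show ?thesis using False assms
      by (simp add: u lie_bracket_def lift_snd_apply N.tangent_const[OF N.vector_field_tangent])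
  qed
qed

text \<open>Vector fields lifted from different factors commute, the inner derivatives again being smooth on the
  product.\<close>

lemma lie_bracket_lift_fst_snd:
  assumes "vector_field \<A> X" "vector_field \<B> W"
  shows "lie_bracket (lB X) (lF W) = (\<lambda>u f. 0)"
proof (intro ext)
  fix u :: "'m \<times> 'n" and f
  obtain p q where u: "u = (p, q)" by fastforce
  show "lie_bracket (lB X) (lF W) u f = 0"
  proof (cases "smooth_fun (prod_atlas \<A> \<B>) f")
    case True
    have "deriv_along (lB X) f = (\<lambda>u. X (fst u) (\<lambda>x. f (x, snd u)))"
      "deriv_along (lF W) f = (\<lambda>u. W (snd u) (\<lambda>y. f (fst u, y)))"
      using True by (auto simp: deriv_along_def lift_fst_apply lift_snd_apply)
    then show ?thesis using True assms derivations_commute[OF True assms, of p q]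
      by (simp add: u lie_bracket_def lift_fst_apply lift_snd_apply
          smooth_fun_derivative_fst smooth_fun_derivative_snd)
  next
    case False
    then have "deriv_along (lB X) f = (\<lambda>u. 0)" "deriv_along (lF W) f = (\<lambda>u. 0)"
      by (auto simp: deriv_along_def lift_fst_apply lift_snd_apply)
    then show ?thesis using False assms
      by (simp add: u lie_bracket_def lift_fst_apply lift_snd_apply
          M.tangent_const[OF M.vector_field_tangent] N.tangent_const[OF N.vector_field_tangent])
  qed
qed

lemma lie_bracket_lift_snd_fst:
  assumes "vector_field \<A> X" "vector_field \<B> W"
  shows "lie_bracket (lF W) (lB X) = (\<lambda>u f. 0)"
proof -
  have "lie_bracket (lF W) (lB X) u f = - lie_bracket (lB X) (lF W) u f" for u f
    by (simp add: lie_bracket_def)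
  then show ?thesis by (simp add: lie_bracket_lift_fst_snd[OF assms] fun_eq_iff)
qed

end

section \<open>The twisted metric on lifts\<close>

lemma (in singular_semi_riemannian) metric_zero_left:
  assumes "w \<in> tangent_space \<A> p" shows "g p (\<lambda>f. 0) w = 0"
  using metric_scale[OF zero_tangent assms, of 0] by (simp add: tvec_scale_def)

lemma (in singular_semi_riemannian) metric_zero_right:
  assumes "w \<in> tangent_space \<A> p" shows "g p w (\<lambda>f. 0) = 0"
  using metric_sym[OF assms zero_tangent] metric_zero_left[OF assms] by simp

lemma (in almost_product) J_zero: "J p (\<lambda>f. 0) = (\<lambda>f. 0)"
  using J_scale[OF zero_tangent, of p 0] by (simp add: tvec_scale_def)

locale twisted_product = B: almost_product \<A> g J + F: almost_product \<B> h K
  for \<A> :: "('m::{second_countable_topology, t2_space}, 'e::real_normed_vector) atlas"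
    and \<B> :: "('n::{second_countable_topology, t2_space}, 'f::real_normed_vector) atlas"
    and g :: "'m tensor2" and h :: "'n tensor2" and J :: "'m endo" and K :: "'n endo" +
  fixes b :: "'m \<times> 'n \<Rightarrow> real"
  assumes smooth_twisting: "smooth_fun (prod_atlas \<A> \<B>) b"

sublocale twisted_product \<subseteq> manifold_pair \<A> \<B>
  by unfold_locales

context twisted_product
begin

abbreviation "G \<equiv> twisted_metric \<A> \<B> g h b"

lemmas zero_simps = B.metric_zero_left B.metric_zero_right F.metric_zero_left F.metric_zero_right
  B.zero_tangent F.zero_tangent
lemmas projection_simps = project_lift_fst project_lift_snd

lemma twisted_metric_lift_fst:
  assumes "\<And>p. X p \<in> tangent_space \<A> p" "\<And>p. Y p \<in> tangent_space \<A> p"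
  shows "eval_tensor G (lB X) (lB Y) = (\<lambda>u. eval_tensor g X Y (fst u))"
  by (rule ext) (auto simp: eval_tensor_def twisted_metric_def projection_simps assms zero_simps)

lemma twisted_metric_lift_fst_snd:
  assumes "\<And>p. X p \<in> tangent_space \<A> p" "\<And>q. W q \<in> tangent_space \<B> q"
  shows "eval_tensor G (lB X) (lF W) = (\<lambda>u. 0)"
  by (rule ext) (auto simp: eval_tensor_def twisted_metric_def projection_simps assms zero_simps)

lemma twisted_metric_lift_snd_fst:
  assumes "\<And>p. X p \<in> tangent_space \<A> p" "\<And>q. W q \<in> tangent_space \<B> q"
  shows "eval_tensor G (lF W) (lB X) = (\<lambda>u. 0)"
  by (rule ext) (auto simp: eval_tensor_def twisted_metric_def projection_simps assms zero_simps)

lemma twisted_metric_lift_snd: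
  assumes "\<And>q. V q \<in> tangent_space \<B> q" "\<And>q. W q \<in> tangent_space \<B> q"
  shows "eval_tensor G (lF V) (lF W) = (\<lambda>u. (b u)\<^sup>2 * eval_tensor h V W (snd u))"
  by (rule ext) (auto simp: eval_tensor_def twisted_metric_def projection_simps assms zero_simps)

lemma pushforward_zero: "pushforward \<C> \<Phi> (\<lambda>f. 0) = (\<lambda>f. 0)"
  by (simp add: pushforward_def)

lemma twisted_metric_zero_fst:
  assumes "\<And>p. X p \<in> tangent_space \<A> p"
  shows "eval_tensor G (lB X) (\<lambda>u f. 0) = (\<lambda>u. 0)"
  by (rule ext) (auto simp: eval_tensor_def twisted_metric_def projection_simps assms zero_simps pushforward_zero)

lemma twisted_metric_zero_snd:
  assumes "\<And>q. W q \<in> tangent_space \<B> q"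
  shows "eval_tensor G (lF W) (\<lambda>u f. 0) = (\<lambda>u. 0)"
  by (rule ext) (auto simp: eval_tensor_def twisted_metric_def projection_simps assms zero_simps pushforward_zero)

lemma derivative_of_pullback_fst:
  assumes "smooth_fun \<A> f"
  shows "deriv_along (lB X) (\<lambda>u. f (fst u)) (p, q) = deriv_along X f p"
    "vector_field \<B> W \<Longrightarrow> deriv_along (lF W) (\<lambda>u. f (fst u)) (p, q) = 0"
  using assms by (simp_all add: deriv_along_def lift_fst_apply lift_snd_apply smooth_fun_pullback_fst
    F.tangent_const[OF F.vector_field_tangent])

lemma derivative_of_zero:
  "vector_field \<A> X \<Longrightarrow> deriv_along (lB X) (\<lambda>u. 0) (p, q) = 0"
  "vector_field \<B> W \<Longrightarrow> deriv_along (lF W) (\<lambda>u. 0) (p, q) = 0"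
  by (simp_all add: deriv_along_def lift_fst_apply lift_snd_apply
    B.tangent_const[OF B.vector_field_tangent] F.tangent_const[OF F.vector_field_tangent])

lemma smooth_fun_twisted:
  "smooth_fun \<B> f \<Longrightarrow> smooth_fun (prod_atlas \<A> \<B>) (\<lambda>u. b u * b u * f (snd u))"
  by (intro smooth_fun_prod_mult smooth_twisting smooth_fun_pullback_snd)

lemma derivative_fst_of_twisted:
  assumes f: "smooth_fun \<B> f" and X: "vector_field \<A> X"
  shows "deriv_along (lB X) (\<lambda>u. (b u)\<^sup>2 * f (snd u)) (p, q) =
    2 * b (p, q) * deriv_along (lB X) b (p, q) * f q"
proof -
  note bq = smooth_fun_slice_fst[OF smooth_twisting, of q]
  note Xp = B.vector_field_tangent[OF X, of p]
  have "X p (\<lambda>x. b (x, q) * b (x, q) * f q) = 2 * b (p, q) * X p (\<lambda>x. b (x, q)) * f q"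
    using B.tangent_cmult[OF Xp B.smooth_fun_mult[OF bq bq], of "f q"] B.tangent_mult[OF Xp bq bq]
    by (simp add: mult_ac)
  then show ?thesis
    by (simp add: deriv_along_def lift_fst_apply smooth_fun_twisted[OF f] smooth_twisting power2_eq_square)
qed

lemma derivative_snd_of_twisted:
  assumes f: "smooth_fun \<B> f" and W: "vector_field \<B> W"
  shows "deriv_along (lF W) (\<lambda>u. (b u)\<^sup>2 * f (snd u)) (p, q) =
    2 * b (p, q) * deriv_along (lF W) b (p, q) * f q + (b (p, q))\<^sup>2 * deriv_along W f q"
proof -
  note bp = smooth_fun_slice_snd[OF smooth_twisting, of p]
  have "W q (\<lambda>y. b (p, y) * b (p, y) * f y) =
      2 * b (p, q) * W q (\<lambda>y. b (p, y)) * f q + b (p, q) * b (p, q) * W q f"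
    by (simp add: F.tangent_mult[OF F.vector_field_tangent[OF W]] F.smooth_fun_mult bp f algebra_simps)
  then show ?thesis
    by (simp add: deriv_along_def lift_snd_apply smooth_fun_twisted[OF f] smooth_twisting power2_eq_square)
qed

text \<open>The almost product structure acts on lifts factor by factor. Hence the almost product Koszul form of
  lifts is a mean of two ordinary Koszul forms of lifts.\<close>

lemma prod_endo_lift_fst:
  assumes "vector_field \<A> X"
  shows "eval_endo (prod_endo \<A> \<B> J K) (lB X) = lB (eval_endo J X)"
proof (rule ext, clarify)
  fix p q
  have "eval_endo (prod_endo \<A> \<B> J K) (lB X) (p, q) =
      pushforward (prod_atlas \<A> \<B>) (\<lambda>x. (x, q)) (J p (X p))"
    by (simp add: eval_endo_def prod_endo_def projection_simps B.vector_field_tangent[OF assms]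
        F.J_zero tvec_add_def pushforward_zero)
  then show "eval_endo (prod_endo \<A> \<B> J K) (lB X) (p, q) = lB (eval_endo J X) (p, q)"
    by (simp add: lift_fst_def eval_endo_def)
qed

lemma prod_endo_lift_snd:
  assumes "vector_field \<B> W"
  shows "eval_endo (prod_endo \<A> \<B> J K) (lF W) = lF (eval_endo K W)"
proof (rule ext, clarify)
  fix p q
  have "eval_endo (prod_endo \<A> \<B> J K) (lF W) (p, q) =
      pushforward (prod_atlas \<A> \<B>) (\<lambda>y. (p, y)) (K q (W q))"
    by (simp add: eval_endo_def prod_endo_def projection_simps F.vector_field_tangent[OF assms]
        B.J_zero tvec_add_def pushforward_zero)
  then show "eval_endo (prod_endo \<A> \<B> J K) (lF W) (p, q) = lF (eval_endo K W) (p, q)"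
    by (simp add: lift_snd_def eval_endo_def)
qed

section \<open>Koszul forms of lifts\<close>

text \<open>Metric coefficients, their derivatives, and brackets of lifts, which together evaluate each of the six
  terms of the Koszul formula.\<close>

lemmas koszul_simps = koszul_def
  twisted_metric_lift_fst twisted_metric_lift_fst_snd twisted_metric_lift_snd_fst twisted_metric_lift_snd
  twisted_metric_zero_fst twisted_metric_zero_snd derivative_of_pullback_fst derivative_of_zero
  derivative_fst_of_twisted derivative_snd_of_twisted
  lie_bracket_lift_fst lie_bracket_lift_snd lie_bracket_lift_fst_snd lie_bracket_lift_snd_fst
  B.vector_field_tangent F.vector_field_tangent B.lie_bracket_tangent F.lie_bracket_tangent
  B.metric_smooth F.metric_smooth

lemma fiber_metric_sym:
  "vector_field \<B> V \<Longrightarrow> vector_field \<B> W \<Longrightarrow> eval_tensor h V W q = eval_tensor h W V q"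
  by (simp add: eval_tensor_def F.metric_sym F.vector_field_tangent)

lemma koszul_base:
  assumes "vector_field \<A> X" "vector_field \<A> Y" "vector_field \<A> Z"
  shows "koszul G (lB X) (lB Y) (lB Z) (p, q) = koszul g X Y Z p"
  using assms by (simp add: koszul_simps)

lemma koszul_mixed_zero:
  assumes "vector_field \<A> X" "vector_field \<A> Y" "vector_field \<B> W"
  shows "koszul G (lB X) (lB Y) (lF W) (p, q) = 0"
  "koszul G (lB X) (lF W) (lB Y) (p, q) = 0"
  "koszul G (lF W) (lB X) (lB Y) (p, q) = 0"
  using assms by (simp_all add: koszul_simps)

text \<open>The function \<open>b\<^sup>2 g\<^sub>F(V, W)\<close> is the only metric coefficient in the formula that does not vanish, and its
  fiber factor is constant along \<open>X\<close>. The same term appears, up to sign, whenever one argument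
  comes from the base and two from the fiber.\<close>

lemma koszul_base_fiber_fiber:
  assumes "vector_field \<A> X" "vector_field \<B> V" "vector_field \<B> W"
  shows "koszul G (lB X) (lF V) (lF W) (p, q) = b (p, q) * deriv_along (lB X) b (p, q) * eval_tensor h V W q"
  using assms by (simp add: koszul_simps)

lemma koszul_fiber_base_fiber:
  assumes "vector_field \<A> X" "vector_field \<B> V" "vector_field \<B> W"
  shows "koszul G (lF V) (lB X) (lF W) (p, q) = b (p, q) * deriv_along (lB X) b (p, q) * eval_tensor h V W q"
  "koszul G (lF V) (lF W) (lB X) (p, q) = - (b (p, q) * deriv_along (lB X) b (p, q) * eval_tensor h V W q)"
  using assms fiber_metric_sym[of V W q] by (simp_all add: koszul_simps)

text \<open>Each of the three derivatives of a metric coefficient \<open>b\<^sup>2 g\<^sub>F\<close> contributes a term with the derivative of \<open>b\<close>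
  and, multiplied by \<open>b\<^sup>2\<close>, the corresponding term of the Koszul form of the fiber.\<close>

lemma koszul_fiber:
  assumes "vector_field \<B> U" "vector_field \<B> V" "vector_field \<B> W"
  shows "koszul G (lF U) (lF V) (lF W) (p, q) =
    b (p, q) * deriv_along (lF U) b (p, q) * eval_tensor h V W q
    + b (p, q) * deriv_along (lF V) b (p, q) * eval_tensor h U W q
    - b (p, q) * deriv_along (lF W) b (p, q) * eval_tensor h U V q
    + (b (p, q))\<^sup>2 * koszul h U V W q"
  using assms fiber_metric_sym[of W U q] by (simp add: koszul_simps) (simp add: field_simps)

end

theorem proposition7p1:
  fixes \<A>\<^sub>B :: "('m::{second_countable_topology, t2_space}, 'e::real_normed_vector) atlas"
    and \<A>\<^sub>F :: "('n::{second_countable_topology, t2_space}, 'f::real_normed_vector) atlas"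
    and g\<^sub>B :: "'m tensor2" and J\<^sub>B :: "'m endo"
    and g\<^sub>F :: "'n tensor2" and J\<^sub>F :: "'n endo"
    and b :: "'m \<times> 'n \<Rightarrow> real"
    and X Y Z :: "'m vfield" and U V W :: "'n vfield"
  assumes "almost_product \<A>\<^sub>B g\<^sub>B J\<^sub>B" and "almost_product \<A>\<^sub>F g\<^sub>F J\<^sub>F"
    and "smooth_fun (prod_atlas \<A>\<^sub>B \<A>\<^sub>F) b"
    and "vector_field \<A>\<^sub>B X" and "vector_field \<A>\<^sub>B Y" and "vector_field \<A>\<^sub>B Z"
    and "vector_field \<A>\<^sub>F U" and "vector_field \<A>\<^sub>F V" and "vector_field \<A>\<^sub>F W"
  shows "let
      K = ap_koszul (twisted_metric \<A>\<^sub>B \<A>\<^sub>F g\<^sub>B g\<^sub>F b) (prod_endo \<A>\<^sub>B \<A>\<^sub>F J\<^sub>B J\<^sub>F);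
      lB = lift_fst \<A>\<^sub>B \<A>\<^sub>F; lF = lift_snd \<A>\<^sub>B \<A>\<^sub>F;
      gF = eval_tensor g\<^sub>F; JB = eval_endo J\<^sub>B; JF = eval_endo J\<^sub>F;
      dB = (\<lambda>X. deriv_along (lB X) b); dF = (\<lambda>V. deriv_along (lF V) b)
    in \<forall>p q.
      K (lB X) (lB Y) (lB Z) (p, q) = ap_koszul g\<^sub>B J\<^sub>B X Y Z p
      \<and> (K (lB X) (lB Y) (lF W) (p, q) = 0
         \<and> K (lB X) (lF W) (lB Y) (p, q) = 0
         \<and> K (lF W) (lB X) (lB Y) (p, q) = 0)
      \<and> K (lB X) (lF V) (lF W) (p, q) = b (p, q) * dB X (p, q) * gF V W q
      \<and> (K (lF V) (lB X) (lF W) (p, q) = - K (lF V) (lF W) (lB X) (p, q)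
         \<and> K (lF V) (lB X) (lF W) (p, q) =
             1/2 * (b (p, q) * dB X (p, q) * gF V W q
                    + b (p, q) * dB (JB X) (p, q) * gF V (JF W) q))
      \<and> K (lF U) (lF V) (lF W) (p, q) =
          b (p, q) * dF U (p, q) * gF V W q
          + 1/2 * b (p, q) * dF V (p, q) * gF U W q
          - 1/2 * b (p, q) * dF W (p, q) * gF U V q
          + 1/2 * b (p, q) * dF (JF V) (p, q) * gF U (JF W) q
          - 1/2 * b (p, q) * dF (JF W) (p, q) * gF U (JF V) q
          + (b (p, q))\<^sup>2 * ap_koszul g\<^sub>F J\<^sub>F U V W q"
proof -
  interpret B: almost_product \<A>\<^sub>B g\<^sub>B J\<^sub>B by fact
  interpret F: almost_product \<A>\<^sub>F g\<^sub>F J\<^sub>F by fact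
  interpret twisted_product \<A>\<^sub>B \<A>\<^sub>F g\<^sub>B g\<^sub>F J\<^sub>B J\<^sub>F b
    by unfold_locales fact
  note fields = assms(4-9)
  note J_fields = B.J_smooth[OF assms(4)] B.J_smooth[OF assms(5)] B.J_smooth[OF assms(6)]
    F.J_smooth[OF assms(7)] F.J_smooth[OF assms(8)] F.J_smooth[OF assms(9)]
  \<comment> \<open>merges the two equal halves of the almost product form of type \<open>(X, V, W)\<close>\<close>
  have isometry: "eval_tensor g\<^sub>F (eval_endo J\<^sub>F V) (eval_endo J\<^sub>F W) q = eval_tensor g\<^sub>F V W q" for q
    using assms(8,9) by (simp add: eval_tensor_def eval_endo_def F.J_isometry F.vector_field_tangent)
  show ?thesis
    unfolding Let_def ap_koszul_def
    by (simp add: fields J_fields prod_endo_lift_fst prod_endo_lift_snd koszul_base koszul_mixed_zero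
        koszul_base_fiber_fiber koszul_fiber_base_fiber koszul_fiber isometry)
      (simp add: field_simps)
qed

end
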